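(* There exist $C>0$, $\rho>0$ and $\delta_0>0$ such that, for every $\delta\in(0,\delta_0)$, $$\forall \xi\in\mathbb{R} \text{ with } |\xi|\ge 1,\qquad \left|\int_0^1 e^{i\xi\psi_\delta(x)}\,dx\right|\le C\,\delta^{-1}|\xi|^{-\rho},$$ where $\psi_\delta$ is the conjugacy between the doubling map and the explicit perturbation $f_\delta$ defined in the context.
   Context: Let $\Phi:\mathbb{R}\to\mathbb{R}$ be the $1$-periodic function with $\Phi(x)=x-\tfrac14$ for $x\in[0,\tfrac12)$ and $\Phi(x)=\tfrac34-x$ for $x\in[\tfrac12,1)$. For $\delta>0$ small enough set $$f_\delta(x):=z_\delta\int_0^{2x}e^{\delta\Phi(t)}\,dt,\qquad z_\delta^{-1}:=\int_0^1 e^{\delta\Phi(t)}\,dt,$$ so that $f_\delta(1/2)=1$. The map $f_\delta$ factors to a map of the circle $\mathbb{S}^1=\mathbb{R}/\mathbb{Z}$ which is a small perturbation of the doubling map $f_0(x)=2x$ and which fixes $0$. For $\delta$ small, there is a homeomorphism $\psi_\delta:\mathbb{S}^1\to\mathbb{S}^1$, Hölder with Hölder inverse, with $\psi_\delta\circ f_0=f_\delta\circ\psi_\delta$ and $\psi_\delta(0)=0$; it is viewed in the integral as an increasing homeomorphism of $[0,1]$. *)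

theory Defs
  imports "HOL-Analysis.Analysis"
begin

definition Phi :: "real \<Rightarrow> real" where
  "Phi x = (if frac x < 1/2 then frac x - 1/4 else 3/4 - frac x)"

definition z_delta :: "real \<Rightarrow> real" where
  "z_delta \<delta> = inverse (LBINT t=0..1. exp (\<delta> * Phi t))"

definition f_delta :: "real \<Rightarrow> real \<Rightarrow> real" where
  "f_delta \<delta> x = z_delta \<delta> * (LBINT t=0..2 * x. exp (\<delta> * Phi t))"

(* The circle R/Z is modelled by the unit circle of the complex plane, with circ as the quotient
   map.  The chordal distance there and the usual distance of R/Z are bi-Lipschitz equivalent,
   so the notions of homeomorphism and of Hoelder map are unaffected. *)

definition circ :: "real \<Rightarrow> complex" where
  "circ t = cis (2 * pi * t)"

(* The map of the circle induced by a map g of the real line; meaningful when g (x + 1) - g x is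
   always an integer, and then circle_map g (circ x) = circ (g x), see circle_map_circ. *)
definition circle_map :: "(real \<Rightarrow> real) \<Rightarrow> complex \<Rightarrow> complex" where
  "circle_map g w = circ (g (Arg2pi w / (2 * pi)))"

definition holder_on :: "'a::metric_space set \<Rightarrow> ('a \<Rightarrow> 'b::metric_space) \<Rightarrow> bool" where
  "holder_on S g \<longleftrightarrow> (\<exists>\<alpha> K. 0 < \<alpha> \<and> \<alpha> \<le> 1 \<and> 0 \<le> K \<and>
     (\<forall>x\<in>S. \<forall>y\<in>S. dist (g x) (g y) \<le> K * dist x y powr \<alpha>))"

definition circle_conjugacy :: "real \<Rightarrow> (complex \<Rightarrow> complex) \<Rightarrow> bool" where
  "circle_conjugacy \<delta> \<Psi> \<longleftrightarrow>
     (\<exists>\<Psi>'. homeomorphism (sphere 0 1) (sphere 0 1) \<Psi> \<Psi>' \<and>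
           holder_on (sphere 0 1) \<Psi> \<and> holder_on (sphere 0 1) \<Psi>') \<and>
     (\<forall>w\<in>sphere 0 1. \<Psi> (circle_map (f_delta 0) w) = circle_map (f_delta \<delta>) (\<Psi> w)) \<and>
     \<Psi> (circ 0) = circ 0"

(* An increasing homeomorphism of [0,1] that represents a conjugacy of the circle.  Values of
   \<psi> outside [0,1] are irrelevant.  Such a \<psi> is unique on [0,1]: the
   decreasing conjugacy of the circle is excluded by monotonicity. *)
definition conjugacy :: "real \<Rightarrow> (real \<Rightarrow> real) \<Rightarrow> bool" where
  "conjugacy \<delta> \<psi> \<longleftrightarrow>
     strict_mono_on {0..1} \<psi> \<and> (\<exists>\<phi>. homeomorphism {0..1} {0..1} \<psi> \<phi>) \<and>
     (\<exists>\<Psi>. circle_conjugacy \<delta> \<Psi> \<and> (\<forall>x\<in>{0..1}. \<Psi> (circ x) = circ (\<psi> x)))"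

lemma Phi_Icc: "0 \<le> x \<Longrightarrow> x < 1/2 \<Longrightarrow> Phi x = x - 1/4" "1/2 \<le> x \<Longrightarrow> x < 1 \<Longrightarrow> Phi x = 3/4 - x"
  by (auto simp: Phi_def frac_eq[THEN iffD2])

lemma Phi_periodic: "Phi (x + 1) = Phi x"
  by (simp add: Phi_def frac_1_eq)

lemma Phi_abs_le: "\<bar>Phi x\<bar> \<le> 1/4"
  using frac_lt_1[of x] frac_ge_0[of x] by (auto simp: Phi_def abs_if)

lemma Phi_measurable [measurable]: "Phi \<in> borel_measurable borel"
  unfolding Phi_def frac_def by measurable

lemma exp_Phi_integrable:
  fixes a b \<delta> :: real
  shows "interval_lebesgue_integrable lborel a b (\<lambda>t. exp (\<delta> * Phi t))"
proof -
  have bd: "norm (exp (\<delta> * Phi t)) \<le> exp (\<bar>\<delta>\<bar> / 4)" for t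
  proof -
    have "\<delta> * Phi t \<le> \<bar>\<delta>\<bar> * \<bar>Phi t\<bar>" by (metis abs_ge_self abs_mult)
    also have "\<dots> \<le> \<bar>\<delta>\<bar> * (1/4)" by (intro mult_left_mono Phi_abs_le) auto
    finally show ?thesis by simp
  qed
  have *: "set_integrable lborel {c<..<d} (\<lambda>t. exp (\<delta> * Phi t))" for c d :: real
    unfolding set_integrable_def
  proof (rule integrableI_bounded_set[where A="{c<..<d}" and B="exp (\<bar>\<delta>\<bar> / 4)"])
    show "emeasure lborel {c<..<d} < \<infinity>" by (cases "c \<le> d") auto
    show "AE x in lborel. x \<in> {c<..<d} \<longrightarrow>
        norm (indicator {c<..<d} x *\<^sub>R exp (\<delta> * Phi x)) \<le> exp (\<bar>\<delta>\<bar> / 4)"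
      by (intro AE_I2 impI) (simp only: indicator_simps scaleR_one bd)
  qed auto
  show ?thesis unfolding interval_lebesgue_integrable_def by (auto simp: *)
qed

lemma exp_Phi_integral_add:
  fixes a b c :: real
  shows "(LBINT t=a..b. exp (\<delta> * Phi t)) + (LBINT t=b..c. exp (\<delta> * Phi t))
    = (LBINT t=a..c. exp (\<delta> * Phi t))"
  by (rule interval_integral_sum) (simp add: exp_Phi_integrable flip: ereal_min ereal_max)

lemma exp_Phi_integral_shift:
  fixes a b :: real
  shows "(LBINT t=a + 1..b + 1. exp (\<delta> * Phi t)) = (LBINT t=a..b. exp (\<delta> * Phi t))"
proof -
  have "(LBINT t:{a+1<..<b+1}. exp (\<delta> * Phi t)) = (LBINT t:{a<..<b}. exp (\<delta> * Phi t))" for a b :: real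
    unfolding set_lebesgue_integral_def
    apply (subst lborel_integral_real_affine[where c=1 and t=1])
    by (auto intro!: Bochner_Integration.integral_cong simp: indicator_def add.commute[of 1] Phi_periodic)
  from this[of a b] this[of b a] show ?thesis
    by (simp add: interval_lebesgue_integral_def)
qed

lemma exp_Phi_integral_pos: "(LBINT t=0..1. exp (\<delta> * Phi t)) > 0"
proof -
  have "exp (-\<bar>\<delta>\<bar>) \<le> exp (\<delta> * Phi t)" for t
  proof -
    have "-(\<delta> * Phi t) \<le> \<bar>\<delta>\<bar> * \<bar>Phi t\<bar>" by (metis abs_ge_minus_self abs_mult)
    also have "\<dots> \<le> \<bar>\<delta>\<bar> * 1" by (intro mult_left_mono order.trans[OF Phi_abs_le]) auto
    finally show ?thesis by simp
  qed
  moreover have "set_integrable lborel {0<..<1} (\<lambda>t. exp (\<delta> * Phi t))"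
    using exp_Phi_integrable[of 0 1 \<delta>] by (simp add: interval_lebesgue_integrable_def)
  ultimately have "(LBINT t:{0<..<1::real}. exp (-\<bar>\<delta>\<bar>)) \<le> (LBINT t:{0<..<1}. exp (\<delta> * Phi t))"
    by (intro set_integral_mono) (simp_all add: set_integrable_def)
  moreover have "(LBINT t:{0<..<1::real}. exp (-\<bar>\<delta>\<bar>)) = exp (-\<bar>\<delta>\<bar>)"
    by (simp add: set_lebesgue_integral_def)
  ultimately have "exp (-\<bar>\<delta>\<bar>) \<le> (LBINT t:{0<..<1}. exp (\<delta> * Phi t))" by simp
  then show ?thesis
    by (intro less_le_trans[OF exp_gt_zero]) (simp add: interval_lebesgue_integral_def zero_ereal_def one_ereal_def)
qed

lemma f_delta_half: "f_delta \<delta> (1/2) = 1"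
  using exp_Phi_integral_pos[of \<delta>] by (simp add: f_delta_def z_delta_def one_ereal_def)

lemma f_delta_0: "f_delta 0 x = 2 * x"
  by (simp add: f_delta_def z_delta_def zero_ereal_def one_ereal_def)

lemma f_delta_add_1: "f_delta \<delta> (x + 1) = f_delta \<delta> x + 2"
proof -
  define J where "J a b = (LBINT t=ereal a..ereal b. exp (\<delta> * Phi t))" for a b
  have "J 0 (2 * (x + 1)) = J 0 1 + J 1 2 + J 2 (2 * (x + 1))"
    unfolding J_def exp_Phi_integral_add ..
  moreover have "J 1 2 = J 0 1"
    using exp_Phi_integral_shift[of 0 1] by (simp add: J_def)
  moreover have "J 2 (2 * (x + 1)) = J 0 (2 * x)"
    using exp_Phi_integral_shift[of 0 "2 * x"] exp_Phi_integral_shift[of 1 "2 * x + 1"]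
    by (simp add: J_def algebra_simps)
  ultimately have "J 0 (2 * (x + 1)) = 2 * J 0 1 + J 0 (2 * x)" by simp
  moreover have "f_delta \<delta> y = J 0 (2 * y) / J 0 1" for y
    by (simp add: f_delta_def z_delta_def J_def zero_ereal_def one_ereal_def field_simps)
  moreover have "J 0 1 > 0"
    using exp_Phi_integral_pos by (simp add: J_def zero_ereal_def one_ereal_def)
  ultimately show ?thesis
    by (metis add_divide_distrib add.commute less_irrefl nonzero_mult_div_cancel_right)
qed

lemma circ_eq_iff: "circ x = circ y \<longleftrightarrow> x - y \<in> \<int>"
proof -
  have "circ x = circ y \<longleftrightarrow> (\<exists>n::int. 2 * pi * x = 2 * pi * y + 2 * pi * n)"
    unfolding circ_def cis_conv_exp exp_eq
    by (auto simp: complex_eq_iff algebra_simps)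
  also have "\<dots> \<longleftrightarrow> (\<exists>n::int. x - y = n)"
  proof -
    have "2 * pi * x = 2 * pi * y + 2 * pi * n \<longleftrightarrow> 2 * pi * (x - y) = 2 * pi * n" for n
      by (simp only: right_diff_distrib) linarith
    then show ?thesis by simp
  qed
  finally show ?thesis by (auto simp: Ints_def)
qed

lemma circle_map_circ:
  assumes "\<And>x. g (x + 1) - g x \<in> \<int>"
  shows "circle_map g (circ x) = circ (g x)"
proof -
  have nat: "g (x + real n) - g x \<in> \<int>" for n :: nat and x
  proof (induction n)
    case (Suc n)
    have "g (x + real (Suc n)) - g x = (g (x + real n + 1) - g (x + real n)) + (g (x + real n) - g x)"
      by (simp add: algebra_simps)
    then show ?case using Suc assms by (metis Ints_add)
  qed auto
  have int: "g a - g b \<in> \<int>" if ab: "a - b \<in> \<int>" for a b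
  proof -
    obtain k :: int where k: "a - b = k" using ab by (auto simp: Ints_def)
    show ?thesis
    proof (cases "k \<ge> 0")
      case True
      then have "a = b + real (nat k)" using k by simp
      then show ?thesis using nat[of b "nat k"] by simp
    next
      case False
      then have "b = a + real (nat (- k))" using k by simp
      then have "g b - g a \<in> \<int>" using nat[of a "nat (- k)"] by simp
      then show ?thesis using Ints_minus by fastforce
    qed
  qed
  have "circ (Arg2pi (circ x) / (2 * pi)) = circ x"
    using complex_norm_eq_1_exp[of "circ x"] by (simp add: circ_def flip: cis_conv_exp)
  then show ?thesis
    by (simp add: circle_map_def circ_eq_iff int)
qed

lemma circle_map_f_delta: "circle_map (f_delta \<delta>) (circ x) = circ (f_delta \<delta> x)"
  by (rule circle_map_circ) (simp add: f_delta_add_1)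

end

(* Writing f_delta = F o (doubling) with F a circle diffeomorphism, the inverse branches of f_delta
   are (G x + b) / 2 with G = F^-1 explicit.  The push-forward mu of Lebesgue measure by the conjugacy
   is invariant under averaging over the branches, so the Fourier coefficient of mu at xi is the
   mu-integral of the average of cis (xi * g_w) over all branches g_w of length n.  That average is
   small in L^2 of Lebesgue measure: the derivative of log g_w' is -delta times a perturbed signed
   binary expansion with digits w, hence two words typically give phases with a nondegenerate
   difference, and their correlations decay by van der Corput.  The passage from Lebesgue measure
   back to mu costs only a factor |xi|^O(delta), because mu has dimension close to 1. *)
theory Submission
  imports Defs
begin

text \<open>All scales are powers indexed by \<open>k\<close>. Among the \<open>4^k\<close> words of
  length \<open>2 * k\<close>, at most \<open>2^k\<close> have at a given point a nonlinearity
  within \<open>5^-k / 4\<close> of a given value; these near pairs limit the energy to order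
  \<open>2^-k\<close>. The other pairs must remain small after summation over
  \<open>16 * 5^k\<close> intervals, hence the radius \<open>10^-k\<close> cut out around a
  stationary point, and this requires \<open>2^(21 * k) \<le> |\<xi>| * \<delta>^2\<close>. The
  factor \<open>\<delta>^2\<close> appears because the branches are affine for \<delta> = 0:
  differences of phase derivatives grow only at a rate proportional to \<delta>.

  Returning to mu takes about \<open>4 * ln |\<xi>|\<close> further averagings, each losing a factor
  \<open>exp (\<delta> / 2)\<close>, in total about \<open>|\<xi>|^(2 * \<delta>)\<close>. For
  \<delta> below 1/84 this is at most half of the exponent 1/21 that was gained; the remaining 1/42
  belongs to the squared modulus, hence 1/84 in the end.

  A second obstacle is that the derivative of \<open>G\<close> has a corner at 1/2. Second
  derivatives are therefore taken only inside the two halves of the unit interval, and every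
  interval of integration is kept within one half.\<close>

section \<open>Bi-Lipschitz bounds for the lift of \<open>f_delta\<close>\<close>

definition cumul :: "real \<Rightarrow> real \<Rightarrow> real" where
  "cumul \<delta> u = (LBINT t=ereal 0..ereal u. exp (\<delta> * Phi t))"

lemma exp_Phi_has_integral:
  assumes "u \<le> v"
  shows "((\<lambda>t. exp (\<delta> * Phi t)) has_integral (cumul \<delta> v - cumul \<delta> u)) {u..v}"
proof -
  have bd: "norm (exp (\<delta> * Phi t)) \<le> exp (\<bar>\<delta>\<bar> / 4)" for t
  proof -
    have "\<delta> * Phi t \<le> \<bar>\<delta>\<bar> * \<bar>Phi t\<bar>" by (metis abs_ge_self abs_mult)
    also have "\<dots> \<le> \<bar>\<delta>\<bar> * (1/4)" by (intro mult_left_mono Phi_abs_le) auto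
    finally show ?thesis by simp
  qed
  have int: "set_integrable lborel {u..v} (\<lambda>t. exp (\<delta> * Phi t))"
    unfolding set_integrable_def
  proof (rule integrableI_bounded_set[where A="{u..v}" and B="exp (\<bar>\<delta>\<bar> / 4)"])
    show "AE x in lborel. x \<in> {u..v} \<longrightarrow>
        norm (indicator {u..v} x *\<^sub>R exp (\<delta> * Phi x)) \<le> exp (\<bar>\<delta>\<bar> / 4)"
      by (intro AE_I2 impI) (simp only: indicator_simps scaleR_one bd)
  qed (use assms in auto)
  have "cumul \<delta> v - cumul \<delta> u = (LBINT t=u..v. exp (\<delta> * Phi t))"
    using exp_Phi_integral_add[of 0 u \<delta> v] by (simp add: cumul_def)
  also have "\<dots> = integral {u..v} (\<lambda>t. exp (\<delta> * Phi t))"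
    by (rule interval_integral_eq_integral[OF assms int])
  finally show ?thesis
    using set_borel_integral_eq_integral(1)[OF int] by (simp add: has_integral_iff)
qed

lemma exp_Phi_bounds:
  assumes "0 \<le> \<delta>"
  shows "exp (- \<delta> / 4) \<le> exp (\<delta> * Phi t)" "exp (\<delta> * Phi t) \<le> exp (\<delta> / 4)"
proof -
  have "- (1/4) \<le> Phi t" "Phi t \<le> 1/4" using Phi_abs_le[of t] by auto
  then have "\<delta> * (- (1/4)) \<le> \<delta> * Phi t" "\<delta> * Phi t \<le> \<delta> * (1/4)"
    using assms by (intro mult_left_mono; simp)+
  then show "exp (- \<delta> / 4) \<le> exp (\<delta> * Phi t)" "exp (\<delta> * Phi t) \<le> exp (\<delta> / 4)"
    by auto
qed

lemma cumul_diff_bounds: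
  assumes "0 \<le> \<delta>" "u \<le> v"
  shows "exp (- \<delta> / 4) * (v - u) \<le> cumul \<delta> v - cumul \<delta> u"
    and "cumul \<delta> v - cumul \<delta> u \<le> exp (\<delta> / 4) * (v - u)"
proof -
  note I = exp_Phi_has_integral[OF assms(2), of \<delta>]
  have c: "((\<lambda>t. c) has_integral c * (v - u)) {u..v}" for c :: real
    using has_integral_const_real[of c u v] assms by (simp add: mult.commute)
  show "exp (- \<delta> / 4) * (v - u) \<le> cumul \<delta> v - cumul \<delta> u"
    by (rule has_integral_le[OF c I]) (rule exp_Phi_bounds[OF assms(1)])
  show "cumul \<delta> v - cumul \<delta> u \<le> exp (\<delta> / 4) * (v - u)"
    by (rule has_integral_le[OF I c]) (rule exp_Phi_bounds[OF assms(1)])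
qed

lemma cumul_0: "cumul \<delta> 0 = 0"
  by (simp add: cumul_def)

lemma cumul_1_pos: "cumul \<delta> 1 > 0"
  using exp_Phi_integral_pos[of \<delta>] by (simp add: cumul_def zero_ereal_def one_ereal_def)

lemma cumul_add_1: "cumul \<delta> (u + 1) = cumul \<delta> u + cumul \<delta> 1"
  using exp_Phi_integral_shift[of 0 u \<delta>] exp_Phi_integral_add[of 0 1 \<delta> "u + 1"]
  by (simp add: cumul_def zero_ereal_def one_ereal_def)

lemma f_delta_eq: "f_delta \<delta> x = cumul \<delta> (2 * x) / cumul \<delta> 1"
  by (simp add: f_delta_def z_delta_def cumul_def zero_ereal_def one_ereal_def field_simps)

lemma f_delta_at_0: "f_delta \<delta> 0 = 0"
  by (simp add: f_delta_eq cumul_0)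

lemma f_delta_add_half: "f_delta \<delta> (x + 1/2) = f_delta \<delta> x + 1"
  using cumul_add_1[of \<delta> "2 * x"] cumul_1_pos[of \<delta>]
  by (simp add: f_delta_eq distrib_left add_divide_distrib)

text \<open>The density lies between \<open>exp (- \<delta> / 4)\<close> and
  \<open>exp (\<delta> / 4)\<close>, and so does its mean \<open>cumul \<delta> 1\<close>; the
  quotient of the two loses \<open>exp (\<delta> / 2)\<close> in each direction.\<close>

lemma f_delta_diff_bounds:
  assumes "0 \<le> \<delta>" "x \<le> y"
  shows "2 * exp (- \<delta> / 2) * (y - x) \<le> f_delta \<delta> y - f_delta \<delta> x"
    and "f_delta \<delta> y - f_delta \<delta> x \<le> 2 * exp (\<delta> / 2) * (y - x)"
proof -
  note c1 = cumul_diff_bounds[OF assms(1), of 0 1, simplified cumul_0, simplified]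
  note d = cumul_diff_bounds[OF assms(1), of "2 * x" "2 * y"]
  have eq: "f_delta \<delta> y - f_delta \<delta> x = (cumul \<delta> (2 * y) - cumul \<delta> (2 * x)) / cumul \<delta> 1"
    by (simp add: f_delta_eq diff_divide_distrib)
  have e: "exp (- \<delta> / 2) * exp (\<delta> / 4) = exp (- \<delta> / 4)"
    "exp (\<delta> / 2) * exp (- \<delta> / 4) = exp (\<delta> / 4)"
    by (simp_all flip: exp_add)
  have "2 * exp (- \<delta> / 2) * (y - x) * cumul \<delta> 1 \<le> 2 * exp (- \<delta> / 2) * (y - x) * exp (\<delta> / 4)"
    using assms c1 by (intro mult_left_mono) auto
  also have "\<dots> = exp (- \<delta> / 4) * (2 * y - 2 * x)"
    using e(1) by (simp add: algebra_simps)
  also have "\<dots> \<le> cumul \<delta> (2 * y) - cumul \<delta> (2 * x)"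
    using assms d by auto
  finally show "2 * exp (- \<delta> / 2) * (y - x) \<le> f_delta \<delta> y - f_delta \<delta> x"
    unfolding eq using cumul_1_pos[of \<delta>] by (simp add: pos_le_divide_eq)
  have "cumul \<delta> (2 * y) - cumul \<delta> (2 * x) \<le> exp (\<delta> / 4) * (2 * y - 2 * x)"
    using assms d by auto
  also have "\<dots> = 2 * exp (\<delta> / 2) * (y - x) * exp (- \<delta> / 4)"
    unfolding e(2)[symmetric] by (simp add: algebra_simps)
  also have "\<dots> \<le> 2 * exp (\<delta> / 2) * (y - x) * cumul \<delta> 1"
    using assms c1 by (intro mult_left_mono) auto
  finally show "f_delta \<delta> y - f_delta \<delta> x \<le> 2 * exp (\<delta> / 2) * (y - x)"
    unfolding eq using cumul_1_pos[of \<delta>] by (simp add: pos_divide_le_eq)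
qed

lemma f_delta_abs_bounds:
  assumes "0 \<le> \<delta>"
  shows "2 * exp (- \<delta> / 2) * \<bar>x - y\<bar> \<le> \<bar>f_delta \<delta> x - f_delta \<delta> y\<bar>"
    and "\<bar>f_delta \<delta> x - f_delta \<delta> y\<bar> \<le> 2 * exp (\<delta> / 2) * \<bar>x - y\<bar>"
proof -
  have le: "2 * exp (- \<delta> / 2) * \<bar>x - y\<bar> \<le> \<bar>f_delta \<delta> x - f_delta \<delta> y\<bar> \<and>
     \<bar>f_delta \<delta> x - f_delta \<delta> y\<bar> \<le> 2 * exp (\<delta> / 2) * \<bar>x - y\<bar>" if "x \<le> y" for x y
  proof -
    have "0 \<le> 2 * exp (- \<delta> / 2) * (y - x)" using that by simp
    moreover have "\<bar>x - y\<bar> = y - x" using that by simp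
    moreover have "\<bar>f_delta \<delta> x - f_delta \<delta> y\<bar> = f_delta \<delta> y - f_delta \<delta> x"
      using f_delta_diff_bounds(1)[OF assms that] \<open>0 \<le> 2 * exp (- \<delta> / 2) * (y - x)\<close> by linarith
    ultimately show ?thesis
      using f_delta_diff_bounds[OF assms that] by simp
  qed
  show "2 * exp (- \<delta> / 2) * \<bar>x - y\<bar> \<le> \<bar>f_delta \<delta> x - f_delta \<delta> y\<bar>"
    "\<bar>f_delta \<delta> x - f_delta \<delta> y\<bar> \<le> 2 * exp (\<delta> / 2) * \<bar>x - y\<bar>"
    using le[of x y] le[of y x] by (cases "x \<le> y"; auto simp: abs_minus_commute)+
qed

lemma strict_mono_f_delta: "0 \<le> \<delta> \<Longrightarrow> strict_mono (f_delta \<delta>)"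
proof (rule strict_monoI)
  fix x y :: real assume "0 \<le> \<delta>" "x < y"
  then have "0 < 2 * exp (- \<delta> / 2) * (y - x)" by simp
  then show "f_delta \<delta> x < f_delta \<delta> y"
    using f_delta_diff_bounds(1)[of \<delta> x y] \<open>0 \<le> \<delta>\<close> \<open>x < y\<close> by linarith
qed

lemma continuous_f_delta: "0 \<le> \<delta> \<Longrightarrow> continuous_on S (f_delta \<delta>)"
  by (rule lipschitz_on_continuous_on[of "2 * exp (\<delta> / 2)"], rule lipschitz_onI)
     (auto simp: dist_real_def intro: f_delta_abs_bounds)

lemma f_delta_add_int: "f_delta \<delta> (x + of_int k) = f_delta \<delta> x + 2 * of_int k"
proof (induction k rule: int_induct[of _ 0])
  case (step1 i)
  then show ?case using f_delta_add_1[of \<delta> "x + of_int i"] by (simp add: add.assoc)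
next
  case (step2 i)
  then show ?case using f_delta_add_1[of \<delta> "x + of_int (i - 1)"] by (simp add: algebra_simps)
qed simp

text \<open>On \<open>{0..1}\<close> both terms lie in \<open>{0..2}\<close>, and their difference
  has period 1. Summed along an orbit with weights \<open>1 / 2^(n + 1)\<close>, this bound makes
  the series for \<open>lin\<close> converge and keeps \<open>lin\<close> within 2 of the
  identity.\<close>

lemma f_delta_near_double:
  assumes "0 \<le> \<delta>"
  shows "\<bar>f_delta \<delta> y - 2 * y\<bar> \<le> 2"
proof -
  have "f_delta \<delta> y = f_delta \<delta> (frac y) + 2 * of_int \<lfloor>y\<rfloor>"
    using f_delta_add_int[of \<delta> "frac y" "\<lfloor>y\<rfloor>"] by (simp add: frac_def)
  moreover have "f_delta \<delta> 0 \<le> f_delta \<delta> (frac y)" "f_delta \<delta> (frac y) \<le> f_delta \<delta> 1"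
    using strict_mono_f_delta[OF assms] by (simp_all add: strict_mono_less_eq less_imp_le frac_lt_1)
  moreover have "f_delta \<delta> 1 = 2" using f_delta_add_1[of \<delta> 0] by (simp add: f_delta_at_0)
  ultimately show ?thesis
    using frac_lt_1[of y] frac_ge_0[of y] unfolding f_delta_at_0 frac_def by linarith
qed

subsection \<open>Hoelder maps of the circle\<close>

text \<open>Both orbits are followed until they are about 1 apart: \<open>S\<close> separates the
  points at rate at most \<Lambda>, \<open>T\<close> separates the images at rate at least \<kappa>,
  and \<open>near\<close> bounds the final distance of the images. This serves \<open>lin\<close>
  and its inverse alike, with the roles of doubling and \<open>f\<close> exchanged.\<close>

lemma holder_of_semiconjugacy:
  fixes u S T :: "real \<Rightarrow> real"
  assumes T: "\<And>p q. \<kappa> * \<bar>p - q\<bar> \<le> \<bar>T p - T q\<bar>"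
    and S: "\<And>p q. \<bar>S p - S q\<bar> \<le> \<Lambda> * \<bar>p - q\<bar>"
    and \<kappa>: "1 < \<kappa>" and \<Lambda>: "1 < \<Lambda>" and conj: "\<And>x. T (u x) = u (S x)"
    and near: "\<And>x y. \<bar>x - y\<bar> \<le> 1 \<Longrightarrow> \<bar>u x - u y\<bar> \<le> 1"
    and xy: "\<bar>x - y\<bar> \<le> 1"
  shows "\<bar>u x - u y\<bar> \<le> \<kappa> * \<bar>x - y\<bar> powr (ln \<kappa> / ln \<Lambda>)"
proof (cases "x = y")
  case False
  define d where "d = \<bar>x - y\<bar>"
  have d: "0 < d" "d \<le> 1" using False xy by (auto simp: d_def)
  \<comment> \<open>The last time with \<open>\<Lambda> ^ n * d \<le> 1\<close>; rounding down costs
    the factor \<kappa> in the constant.\<close>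
  define n where "n = nat \<lfloor>- ln d / ln \<Lambda>\<rfloor>"
  have "0 \<le> - ln d / ln \<Lambda>" using d \<Lambda> by (intro divide_nonneg_pos) auto
  then have n: "real n \<le> - ln d / ln \<Lambda>" "- ln d / ln \<Lambda> < real (Suc n)"
    unfolding n_def by linarith+
  have Sn: "\<bar>(S ^^ m) x - (S ^^ m) y\<bar> \<le> \<Lambda> ^ m * d" for m
  proof (induction m)
    case (Suc m)
    have "\<bar>(S ^^ Suc m) x - (S ^^ Suc m) y\<bar> \<le> \<Lambda> * \<bar>(S ^^ m) x - (S ^^ m) y\<bar>"
      using S by simp
    also have "\<dots> \<le> \<Lambda> * (\<Lambda> ^ m * d)" using Suc \<Lambda> by (intro mult_left_mono) auto
    finally show ?case by simp
  qed (simp add: d_def)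
  have Tn: "\<kappa> ^ m * \<bar>u x - u y\<bar> \<le> \<bar>u ((S ^^ m) x) - u ((S ^^ m) y)\<bar>" for m
  proof (induction m)
    case (Suc m)
    have "\<kappa> ^ Suc m * \<bar>u x - u y\<bar> \<le> \<kappa> * \<bar>u ((S ^^ m) x) - u ((S ^^ m) y)\<bar>"
      using Suc \<kappa> by (simp add: mult.assoc)
    also have "\<dots> \<le> \<bar>u ((S ^^ Suc m) x) - u ((S ^^ Suc m) y)\<bar>"
      using T by (simp flip: conj)
    finally show ?case .
  qed simp
  have "\<Lambda> ^ n * d \<le> 1"
  proof -
    have "ln (\<Lambda> ^ n * d) \<le> 0" using n(1) d \<Lambda> by (simp add: ln_mult ln_realpow field_simps)
    then show ?thesis using d \<Lambda> by (subst (asm) ln_le_zero_iff) simp_all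
  qed
  then have "\<kappa> ^ n * \<bar>u x - u y\<bar> \<le> 1"
    using Tn[of n] Sn[of n] near by (meson order_trans)
  moreover have "1 \<le> \<kappa> ^ n * (\<kappa> * d powr (ln \<kappa> / ln \<Lambda>))"
  proof -
    have "0 \<le> real (Suc n) * ln \<kappa> + (ln \<kappa> / ln \<Lambda>) * ln d"
    proof -
      have "- ln d / ln \<Lambda> * ln \<kappa> \<le> real (Suc n) * ln \<kappa>"
        using n(2) \<kappa> by (intro mult_right_mono) auto
      then show ?thesis by (simp add: algebra_simps)
    qed
    also have "\<dots> = ln (\<kappa> ^ n * (\<kappa> * d powr (ln \<kappa> / ln \<Lambda>)))"
      using \<kappa> d by (simp add: ln_mult ln_realpow ln_powr algebra_simps)
    finally show ?thesis using \<kappa> d by (subst (asm) ln_ge_zero_iff) simp_all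
  qed
  ultimately have "\<kappa> ^ n * \<bar>u x - u y\<bar> \<le> \<kappa> ^ n * (\<kappa> * d powr (ln \<kappa> / ln \<Lambda>))" by linarith
  moreover have "0 < \<kappa> ^ n" using \<kappa> by simp
  ultimately show ?thesis unfolding d_def by (rule mult_left_le_imp_le)
qed simp

lemma dist_circ: "dist (circ a) (circ b) = 2 * \<bar>sin (pi * (a - b))\<bar>"
proof -
  have "(cmod (circ a - circ b))\<^sup>2 = (cos (2 * pi * a) - cos (2 * pi * b))\<^sup>2 + (sin (2 * pi * a) - sin (2 * pi * b))\<^sup>2"
    by (simp add: circ_def cmod_power2)
  also have "\<dots> = 2 - 2 * cos (2 * pi * a - 2 * pi * b)"
    using sin_cos_squared_add[of "2 * pi * a"] sin_cos_squared_add[of "2 * pi * b"]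
    unfolding cos_diff by (simp add: power2_eq_square algebra_simps)
  also have "2 * pi * a - 2 * pi * b = 2 * (pi * (a - b))" by (simp add: algebra_simps)
  also have "2 - 2 * cos (2 * (pi * (a - b))) = (2 * \<bar>sin (pi * (a - b))\<bar>)\<^sup>2"
    by (simp add: cos_double_sin power_mult_distrib)
  finally show ?thesis
    by (subst (asm) power2_eq_iff_nonneg) (simp_all add: dist_norm)
qed

lemma dist_circ_le: "dist (circ a) (circ b) \<le> 2 * pi * \<bar>a - b\<bar>"
  using abs_sin_x_le_abs_x[of "pi * (a - b)"] by (simp add: dist_circ abs_mult)

lemma dist_circ_ge:
  assumes "\<bar>a - b\<bar> \<le> 1/2"
  shows "\<bar>a - b\<bar> \<le> dist (circ a) (circ b)"
proof -
  have "2 * t \<le> sin (pi * t)" if t: "0 \<le> t" "t \<le> 1/2" for t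
  proof -
    \<comment> \<open>Jordan's inequality: the graph of sine lies above its chord from 0 to
      \<open>pi/2\<close>.\<close>
    have "concave_on {0..pi/2} sin"
      by (rule f''_le0_imp_concave[where f'=cos and f''="\<lambda>x. - sin x"])
         (auto intro!: derivative_eq_intros sin_ge_zero)
    from concave_onD[OF this, of "2 * t" 0 "pi/2"] t
    show ?thesis by (simp add: mult.commute)
  qed
  from this[of "\<bar>a - b\<bar>"] assms have "2 * \<bar>a - b\<bar> \<le> sin (pi * \<bar>a - b\<bar>)" by simp
  also have "\<dots> \<le> \<bar>sin (pi * (a - b))\<bar>"
  proof (cases "a \<le> b")
    case True
    then have "pi * \<bar>a - b\<bar> = - (pi * (a - b))" by (simp add: algebra_simps)
    then show ?thesis by (simp only: sin_minus)
  qed auto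
  also have "\<dots> \<le> dist (circ a) (circ b)" by (simp add: dist_circ)
  finally have "2 * \<bar>a - b\<bar> \<le> dist (circ a) (circ b)" .
  moreover have "\<bar>a - b\<bar> \<le> 2 * \<bar>a - b\<bar>" by simp
  ultimately show ?thesis by (rule order_trans[rotated])
qed

lemma circ_surj:
  assumes "w \<in> sphere 0 1"
  obtains x where "w = circ x"
proof -
  have "w = cis (Arg2pi w)"
    using Arg2pi_eq[of w] assms by (simp add: cis_conv_exp)
  then have "w = circ (Arg2pi w / (2 * pi))" by (simp add: circ_def)
  then show thesis by (rule that)
qed

lemma circ_in_sphere: "circ x \<in> sphere 0 1"
  by (simp add: circ_def)

lemma circ_close_representatives:
  obtains y' where "circ y' = circ y" "\<bar>x - y'\<bar> \<le> 1/2"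
proof
  show "circ (y + round (x - y)) = circ y" by (simp add: circ_eq_iff)
  show "\<bar>x - (y + round (x - y))\<bar> \<le> 1/2"
    using of_int_round_abs_le[of "x - y"] by linarith
qed

text \<open>Two points of the circle have lifts at most 1/2 apart. At that range the chord dominates
  the distance of the lifts, so a Hoelder estimate on the line descends to the circle.\<close>

lemma holder_on_circle_map:
  assumes per: "\<And>x. u (x + 1) = u x + 1"
    and hol: "\<And>x y. \<bar>x - y\<bar> \<le> 1 \<Longrightarrow> \<bar>u x - u y\<bar> \<le> K * \<bar>x - y\<bar> powr \<alpha>"
    and \<alpha>: "0 < \<alpha>" "\<alpha> \<le> 1" and K: "0 \<le> K"
  shows "holder_on (sphere 0 1) (circle_map u)"
proof -
  have cm: "circle_map u (circ x) = circ (u x)" for x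
    by (rule circle_map_circ) (simp add: per)
  have "dist (circle_map u v) (circle_map u w) \<le> (2 * pi * K) * dist v w powr \<alpha>"
    if vw: "v \<in> sphere 0 1" "w \<in> sphere 0 1" for v w
  proof -
    obtain x where x: "v = circ x" by (rule circ_surj[OF vw(1)])
    obtain y0 where y0: "w = circ y0" by (rule circ_surj[OF vw(2)])
    obtain y where "circ y = circ y0" and xy: "\<bar>x - y\<bar> \<le> 1/2"
      by (rule circ_close_representatives)
    then have y: "w = circ y" using y0 by simp
    have "dist (circ (u x)) (circ (u y)) \<le> 2 * pi * \<bar>u x - u y\<bar>" by (rule dist_circ_le)
    also have "\<dots> \<le> 2 * pi * (K * \<bar>x - y\<bar> powr \<alpha>)"
      using xy by (intro mult_left_mono hol) auto
    also have "\<dots> \<le> 2 * pi * (K * dist (circ x) (circ y) powr \<alpha>)"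
      using xy \<alpha> K by (intro mult_left_mono powr_mono2 dist_circ_ge) auto
    finally show ?thesis by (simp add: x y cm)
  qed
  then show ?thesis
    unfolding holder_on_def using \<alpha> K by (intro exI[of _ \<alpha>] exI[of _ "2 * pi * K"]) auto
qed

lemma holder_on_imp_continuous_on:
  assumes "holder_on S g"
  shows "continuous_on S g"
proof -
  obtain \<alpha> K where h: "0 < \<alpha>" "0 \<le> K" "\<And>x y. x \<in> S \<Longrightarrow> y \<in> S \<Longrightarrow> dist (g x) (g y) \<le> K * dist x y powr \<alpha>"
    using assms by (auto simp: holder_on_def)
  show ?thesis
    unfolding continuous_on_def
  proof
    fix x assume x: "x \<in> S"
    have "((\<lambda>y. K * dist y x powr \<alpha>) \<longlongrightarrow> K * 0) (at x within S)"
    proof (intro tendsto_mult tendsto_const)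
      have "((\<lambda>y. dist y x) \<longlongrightarrow> dist x x) (at x within S)"
        by (intro tendsto_intros)
      then have "((\<lambda>y. dist y x) \<longlongrightarrow> 0) (at x within S)" by simp
      then show "((\<lambda>y. dist y x powr \<alpha>) \<longlongrightarrow> 0) (at x within S)"
        using h(1) by (intro tendsto_zero_powrI[where b=\<alpha>]) auto
    qed
    then have "((\<lambda>y. dist (g y) (g x)) \<longlongrightarrow> 0) (at x within S)"
      by (intro Lim_null_comparison[where f="\<lambda>y. dist (g y) (g x)"])
         (auto simp: eventually_at_filter x intro!: h(3) always_eventually)
    then show "(g \<longlongrightarrow> g x) (at x within S)" by (rule tendsto_dist_iff[THEN iffD2])
  qed
qed

lemma lift_local_bound:
  fixes u :: "real \<Rightarrow> real"
  assumes "strict_mono u" and per: "\<And>x. u (x + 1) = u x + 1" and "\<bar>x - y\<bar> \<le> 1"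
  shows "\<bar>u x - u y\<bar> \<le> 1"
proof -
  have le: "\<bar>u x - u y\<bar> \<le> 1" if "x \<le> y" "y \<le> x + 1" for x y
  proof -
    have "u x \<le> u y" "u y \<le> u (x + 1)"
      using that by (simp_all only: strict_mono_less_eq[OF assms(1)])
    then show ?thesis by (simp add: per)
  qed
  show ?thesis
  proof (cases "x \<le> y")
    case False
    then show ?thesis using le[of y x] assms(3) by (simp add: abs_minus_commute)
  qed (use le[of x y] assms(3) in simp)
qed

lemma continuous_on_local_holder:
  fixes u :: "real \<Rightarrow> real"
  assumes hol: "\<And>x y. \<bar>x - y\<bar> \<le> 1 \<Longrightarrow> \<bar>u x - u y\<bar> \<le> K * \<bar>x - y\<bar> powr \<alpha>" and \<alpha>: "0 < \<alpha>"
  shows "continuous_on S u"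
proof -
  have "isCont u x" for x
  proof -
    have "((\<lambda>y. y - x) \<longlongrightarrow> x - x) (at x)" by (intro tendsto_intros)
    then have "((\<lambda>y. \<bar>y - x\<bar> powr \<alpha>) \<longlongrightarrow> 0) (at x)"
      using \<alpha> by (intro tendsto_zero_powrI[where b="\<alpha>"]) (auto intro!: tendsto_rabs_zero)
    then have lim: "((\<lambda>y. K * \<bar>y - x\<bar> powr \<alpha>) \<longlongrightarrow> 0) (at x)"
      using tendsto_mult_right_zero by blast
    have "eventually (\<lambda>y. \<bar>y - x\<bar> \<le> 1) (at x)"
      unfolding eventually_at by (intro exI[of _ 1]) (auto simp: dist_real_def)
    then have "((\<lambda>y. u y - u x) \<longlongrightarrow> 0) (at x)"
      by (intro Lim_null_comparison[OF _ lim]) (auto elim!: eventually_mono intro: hol)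
    then show ?thesis unfolding isCont_def by (rule Lim_null[THEN iffD2])
  qed
  then show ?thesis by (simp add: continuous_at_imp_continuous_on)
qed

subsection \<open>Existence of the conjugacy\<close>

text \<open>The count of exponents in \<open>fourier_decay\<close> asks for
  \<open>\<delta> \<le> 1/84\<close>; the value 1/100 also provides the numerical margins in the
  estimates of \<open>p\<close> and \<open>nonlin\<close>.\<close>

locale small_delta =
  fixes \<delta> :: real
  assumes \<delta>_pos: "0 < \<delta>" and \<delta>_le: "\<delta> \<le> 1/100"
begin

abbreviation f :: "real \<Rightarrow> real" where
  "f \<equiv> f_delta \<delta>"

text \<open>The conjugacy to doubling is \<open>lim f^n y / 2^n\<close>, written as a telescoping series.\<close>

definition lin :: "real \<Rightarrow> real" where
  "lin y = y + (\<Sum>n. (f ((f ^^ n) y) - 2 * (f ^^ n) y) / 2 ^ Suc n)"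

lemma lin_term_bound: "\<bar>(f ((f ^^ n) y) - 2 * (f ^^ n) y) / 2 ^ Suc n\<bar> \<le> (1/2) ^ n"
proof -
  have "\<bar>f ((f ^^ n) y) - 2 * (f ^^ n) y\<bar> / 2 ^ Suc n \<le> 2 / 2 ^ Suc n"
    using \<delta>_pos by (intro divide_right_mono f_delta_near_double) auto
  then show ?thesis by (simp add: power_divide)
qed

lemma lin_summable: "summable (\<lambda>n. (f ((f ^^ n) y) - 2 * (f ^^ n) y) / 2 ^ Suc n)"
  by (rule summable_comparison_test'[where g="\<lambda>n. (1/2) ^ n" and N=0])
     (use lin_term_bound in \<open>auto intro: summable_geometric\<close>)

lemma lin_near: "\<bar>lin y - y\<bar> \<le> 2"
proof -
  have "\<bar>\<Sum>n. (f ((f ^^ n) y) - 2 * (f ^^ n) y) / 2 ^ Suc n\<bar> \<le> (\<Sum>n. (1/2) ^ n)"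
    using norm_suminf_le[OF lin_term_bound[folded real_norm_def, of _ y]]
    by (auto intro: summable_geometric)
  then show ?thesis by (simp add: lin_def suminf_geometric)
qed

lemma lin_f: "lin (f y) = 2 * lin y"
proof -
  have "(\<Sum>n. (f ((f ^^ n) y) - 2 * (f ^^ n) y) / 2 ^ Suc n)
      = (\<Sum>n. (f ((f ^^ Suc n) y) - 2 * (f ^^ Suc n) y) / 2 ^ Suc (Suc n)) + (f y - 2 * y) / 2"
    using suminf_split_head[OF lin_summable[of y]] by simp
  also have "(\<Sum>n. (f ((f ^^ Suc n) y) - 2 * (f ^^ Suc n) y) / 2 ^ Suc (Suc n))
      = (\<Sum>n. (f ((f ^^ n) (f y)) - 2 * (f ^^ n) (f y)) / 2 ^ Suc n) / 2"
    using suminf_divide[OF lin_summable[of "f y"], of 2] by (simp add: funpow_swap1 mult.commute)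
  finally show ?thesis by (simp add: lin_def field_simps)
qed

lemma lin_add_1: "lin (y + 1) = lin y + 1"
proof -
  have it: "(f ^^ n) (y + 1) = (f ^^ n) y + 2 ^ n" for n
    using f_delta_add_int[of \<delta> _ "2 ^ m" for m] by (induction n) simp_all
  have "f ((f ^^ n) (y + 1)) - 2 * (f ^^ n) (y + 1) = f ((f ^^ n) y) - 2 * (f ^^ n) y" for n
    unfolding it using f_delta_add_int[of \<delta> "(f ^^ n) y" "2 ^ n"] by simp
  then show ?thesis by (simp add: lin_def)
qed

lemma expansion_gt_1: "1 < 2 * exp (- \<delta> / 2)"
  using exp_ge_add_one_self[of "- \<delta> / 2"] \<delta>_le by simp

text \<open>Order becomes visible at large scale: \<open>f\<close> pulls two orbits apart
  geometrically, and since \<open>lin\<close> is within 2 of the identity, a gap above 4 forces the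
  order of the images. Going back from the iterates only divides by \<open>2 ^ n\<close>.\<close>

lemma lin_strict_mono: "strict_mono lin"
proof (rule strict_monoI)
  fix x y :: real assume xy: "x < y"
  let ?k = "2 * exp (- \<delta> / 2)"
  have gap: "?k ^ n * (y - x) \<le> (f ^^ n) y - (f ^^ n) x" for n
  proof (induction n)
    case (Suc n)
    have pos: "0 \<le> ?k ^ n * (y - x)" using xy by simp
    have "?k ^ Suc n * (y - x) \<le> ?k * ((f ^^ n) y - (f ^^ n) x)"
      using Suc by (simp add: mult.assoc)
    also have "\<dots> \<le> (f ^^ Suc n) y - (f ^^ Suc n) x"
      using Suc pos \<delta>_pos f_delta_diff_bounds(1)[of \<delta> "(f ^^ n) x" "(f ^^ n) y"] by simp
    finally show ?case .
  qed simp
  obtain n where n: "4 / (y - x) < ?k ^ n"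
    using real_arch_pow[OF expansion_gt_1] by blast
  have it: "lin ((f ^^ n) z) = 2 ^ n * lin z" for z
    by (induction n) (simp_all add: lin_f)
  have "4 < ?k ^ n * (y - x)" using n xy by (simp add: divide_less_eq)
  also have "\<dots> \<le> (f ^^ n) y - (f ^^ n) x" by (rule gap)
  also have "\<dots> \<le> 2 ^ n * lin y - 2 ^ n * lin x + 4"
    using lin_near[of "(f ^^ n) x"] lin_near[of "(f ^^ n) y"] unfolding it by linarith
  finally have "2 ^ n * lin x < 2 ^ n * lin y" by simp
  then show "lin x < lin y" by simp
qed

lemma lin_holder:
  "\<bar>x - y\<bar> \<le> 1 \<Longrightarrow> \<bar>lin x - lin y\<bar> \<le> 2 * \<bar>x - y\<bar> powr (ln 2 / ln (2 * exp (\<delta> / 2)))"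
proof (rule holder_of_semiconjugacy[where T="\<lambda>t. 2 * t" and S=f])
  show "1 < 2 * exp (\<delta> / 2)" using \<delta>_pos by (simp add: less_trans[of 1 "exp (\<delta> / 2)"])
  show "\<bar>f p - f q\<bar> \<le> 2 * exp (\<delta> / 2) * \<bar>p - q\<bar>" for p q
    using f_delta_abs_bounds(2)[of \<delta>] \<delta>_pos by simp
  show "\<And>x y. \<bar>x - y\<bar> \<le> 1 \<Longrightarrow> \<bar>lin x - lin y\<bar> \<le> 1"
    by (rule lift_local_bound[OF lin_strict_mono lin_add_1])
  show "2 * \<bar>p - q\<bar> \<le> \<bar>2 * p - 2 * q\<bar>" for p q :: real by (simp add: abs_if)
qed (simp_all add: lin_f)

lemma lin_continuous: "continuous_on S lin"
  by (rule continuous_on_local_holder[OF lin_holder])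
     (use \<delta>_pos in \<open>simp_all add: less_trans[of 1 "exp (\<delta> / 2)"]\<close>)

lemma lin_0: "lin 0 = 0"
  using lin_f[of 0] by (simp add: f_delta_at_0)

lemma lin_surj: "surj lin"
proof -
  have "\<exists>x. lin x = y" for y
  proof -
    have "lin (y - 2) \<le> y" "y \<le> lin (y + 2)"
      using lin_near[of "y - 2"] lin_near[of "y + 2"] by auto
    then show ?thesis
      using IVT'[of lin "y - 2" y "y + 2"] lin_continuous by auto
  qed
  then show ?thesis by (metis surj_def)
qed

definition psi :: "real \<Rightarrow> real" where "psi = inv lin"

lemma lin_psi [simp]: "lin (psi x) = x"
  by (simp add: psi_def surj_f_inv_f lin_surj)

lemma psi_lin [simp]: "psi (lin x) = x"
  by (simp add: psi_def inv_f_f strict_mono_imp_inj_on lin_strict_mono)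

lemma psi_strict_mono: "strict_mono psi"
  by (metis lin_psi lin_strict_mono strict_monoI strict_mono_less)

lemma psi_f: "f (psi x) = psi (2 * x)"
  by (metis lin_f lin_psi psi_lin)

lemma psi_add_1: "psi (x + 1) = psi x + 1"
  by (metis lin_add_1 lin_psi psi_lin)

lemma psi_holder:
  "\<bar>x - y\<bar> \<le> 1 \<Longrightarrow> \<bar>psi x - psi y\<bar> \<le> (2 * exp (- \<delta> / 2)) * \<bar>x - y\<bar> powr (ln (2 * exp (- \<delta> / 2)) / ln 2)"
proof (rule holder_of_semiconjugacy[where T=f and S="\<lambda>t. 2 * t"])
  show "2 * exp (- \<delta> / 2) * \<bar>p - q\<bar> \<le> \<bar>f p - f q\<bar>" for p q
    using f_delta_abs_bounds(1)[of \<delta>] \<delta>_pos by simp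
  show "\<And>x y. \<bar>x - y\<bar> \<le> 1 \<Longrightarrow> \<bar>psi x - psi y\<bar> \<le> 1"
    by (rule lift_local_bound[OF psi_strict_mono psi_add_1])
  show "\<bar>2 * p - 2 * q\<bar> \<le> 2 * \<bar>p - q\<bar>" for p q :: real by (simp add: abs_if)
qed (use expansion_gt_1 in \<open>simp_all add: psi_f\<close>)

lemma psi_continuous: "continuous_on S psi"
  by (rule continuous_on_local_holder[OF psi_holder]) (use expansion_gt_1 in simp_all)

lemma conjugacy_psi: "conjugacy \<delta> psi"
proof -
  \<comment> \<open>In this form the two exponents, \<open>ln 2 / (ln 2 + \<delta> / 2)\<close> and
    \<open>(ln 2 - \<delta> / 2) / ln 2\<close>, are seen to be at most 1, as
    \<open>holder_on\<close> demands.\<close>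
  have l2: "ln (2 * exp (\<delta> / 2)) = ln 2 + \<delta> / 2" "ln (2 * exp (- \<delta> / 2)) = ln 2 - \<delta> / 2"
    by (simp_all add: ln_mult)
  have hl: "holder_on (sphere 0 1) (circle_map lin)"
    by (rule holder_on_circle_map[OF lin_add_1 lin_holder]) (use \<delta>_pos in \<open>auto simp: l2 add_pos_pos\<close>)
  have hp: "holder_on (sphere 0 1) (circle_map psi)"
  proof (rule holder_on_circle_map[OF psi_add_1 psi_holder])
    have "0 < ln (2 * exp (- \<delta> / 2))" using expansion_gt_1 by simp
    then show "0 < ln (2 * exp (- \<delta> / 2)) / ln 2" by simp
  qed (use \<delta>_pos in \<open>auto simp: l2\<close>)
  have cl: "circle_map lin (circ x) = circ (lin x)" for x
    by (rule circle_map_circ) (simp add: lin_add_1)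
  have cp: "circle_map psi (circ x) = circ (psi x)" for x
    by (rule circle_map_circ) (simp add: psi_add_1)
  have hom: "homeomorphism (sphere 0 1) (sphere 0 1) (circle_map psi) (circle_map lin)"
  proof (rule homeomorphismI)
    show "circle_map psi ` sphere 0 1 \<subseteq> sphere 0 1" "circle_map lin ` sphere 0 1 \<subseteq> sphere 0 1"
      using circ_in_sphere by (auto simp: circle_map_def)
    show "circle_map lin (circle_map psi w) = w" "circle_map psi (circle_map lin w) = w"
      if "w \<in> sphere 0 1" for w
      using that by (elim circ_surj, simp add: cl cp)+
  qed (intro holder_on_imp_continuous_on hl hp)+
  have psi0: "psi 0 = 0" by (metis lin_0 psi_lin)
  have psi1: "psi 1 = 1" using psi_add_1[of 0] psi0 by simp
  have lin1: "lin 1 = 1" using lin_add_1[of 0] lin_0 by simp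
  have "circle_conjugacy \<delta> (circle_map psi)"
    unfolding circle_conjugacy_def
  proof (intro conjI ballI)
    show "\<exists>\<Psi>'. homeomorphism (sphere 0 1) (sphere 0 1) (circle_map psi) \<Psi>' \<and>
       holder_on (sphere 0 1) (circle_map psi) \<and> holder_on (sphere 0 1) \<Psi>'"
      using hom hp hl by blast
    show "circle_map psi (circle_map (f_delta 0) w) = circle_map f (circle_map psi w)"
      if "w \<in> sphere 0 1" for w
      using that by (elim circ_surj) (simp add: cp circle_map_f_delta f_delta_0 psi_f)
  qed (simp add: cp psi0)
  moreover have "homeomorphism {0..1} {0..1} psi lin"
    using strict_mono_less_eq[OF psi_strict_mono, of 0] strict_mono_less_eq[OF psi_strict_mono, of _ 1]
      strict_mono_less_eq[OF lin_strict_mono, of 0] strict_mono_less_eq[OF lin_strict_mono, of _ 1]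
    by (intro homeomorphismI psi_continuous lin_continuous) (auto simp: psi0 psi1 lin_0 lin1)
  ultimately show ?thesis
    unfolding conjugacy_def using cp psi_strict_mono
    by (auto simp: strict_mono_on_def strict_mono_def)
qed

end

subsection \<open>Inverse branches\<close>

text \<open>For gluing the two formulas of \<open>G\<close> at 1/2.\<close>

lemma has_real_derivative_split:
  assumes "(g has_real_derivative D) (at x within {..x})" "(g has_real_derivative D) (at x within {x..})"
  shows "(g has_real_derivative D) (at (x::real))"
proof -
  have "((\<lambda>y. (g y - g x) / (y - x)) \<longlongrightarrow> D) (at x within {..x} \<union> {x..})"
    using assms unfolding has_field_derivative_iff by (simp add: Lim_within_Un)
  moreover have "{..x} \<union> {x..} = UNIV" by auto
  ultimately show ?thesis by (simp add: has_field_derivative_iff)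
qed

lemma word_split:
  "{w :: bool list. length w = 2 * Suc k \<and> P w}
     = (\<Union>(b, c)\<in>UNIV. (\<lambda>v. b # c # v) ` {v. length v = 2 * k \<and> P (b # c # v)})"
  by (auto simp: length_Suc_conv image_iff)

lemma finite_words: "finite {w :: bool list. length w = n \<and> P w}"
  by (rule finite_subset[OF _ finite_lists_length_eq[of UNIV n]]) auto

context small_delta
begin

text \<open>\<open>G\<close> is the inverse on \<open>{0..1}\<close> of \<open>x \<mapsto> f (x / 2)\<close>, and \<open>p\<close> is its derivative.\<close>

definition a :: real where "a = 2 * (exp (\<delta> / 2) - 1)"

definition G :: "real \<Rightarrow> real" where
  "G x = (if x \<le> 1/2 then ln (1 + a * x) / \<delta> else 1 - ln (1 + a * (1 - x)) / \<delta>)"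

definition p :: "real \<Rightarrow> real" where
  "p x = a / (\<delta> * (1 + a * min x (1 - x)))"

definition branch :: "bool \<Rightarrow> real \<Rightarrow> real" where
  "branch b x = (G x + of_bool b) / 2"

text \<open>This fixes the value of \<open>a\<close>: both formulas for \<open>G\<close> then take
  the value 1/2 at 1/2.\<close>

lemma a_half: "1 + a / 2 = exp (\<delta> / 2)"
  by (simp add: a_def field_simps)

lemma a_ge: "\<delta> \<le> a"
  using exp_ge_add_one_self[of "\<delta> / 2"] unfolding a_def by (simp add: field_simps)

lemma a_le: "a \<le> \<delta> * (1 + \<delta>)"
proof -
  have "exp (\<delta> / 2) \<le> 1 + \<delta> / 2 + (\<delta> / 2)\<^sup>2"
    using \<delta>_pos \<delta>_le by (intro exp_bound) auto
  then have "a \<le> \<delta> + \<delta> * \<delta> / 2"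
    unfolding a_def by (simp add: power2_eq_square field_simps)
  also have "\<dots> \<le> \<delta> * (1 + \<delta>)" using \<delta>_pos by (simp add: algebra_simps)
  finally show ?thesis .
qed

lemma a_pos: "0 < a"
  using a_ge \<delta>_pos by simp

text \<open>The exponential lower bound is the one iterated in the transfer to mu, where the loss
  per step matters; the linear bounds serve contraction rates and numerical margins.\<close>

lemma p_bounds:
  assumes "x \<in> {0..1}"
  shows "exp (- \<delta> / 2) \<le> p x" "1 - \<delta> \<le> p x" "p x \<le> 1 + \<delta>"
proof -
  define m where "m = min x (1 - x)"
  have m: "0 \<le> m" "m \<le> 1/2" using assms by (auto simp: m_def min_def)
  then have d: "1 \<le> 1 + a * m" "1 + a * m \<le> exp (\<delta> / 2)"
    using a_pos mult_left_mono[of m "1/2" a] by (auto simp flip: a_half)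
  have p: "p x = a / \<delta> / (1 + a * m)" by (simp add: p_def m_def)
  have "exp (- \<delta> / 2) = 1 / exp (\<delta> / 2)" by (simp add: exp_minus[of "\<delta> / 2"] inverse_eq_divide)
  also have "\<dots> \<le> 1 / (1 + a * m)" using d by (intro divide_left_mono) auto
  also have "\<dots> \<le> p x"
    unfolding p using a_ge \<delta>_pos d by (intro divide_right_mono) auto
  finally show *: "exp (- \<delta> / 2) \<le> p x" .
  show "1 - \<delta> \<le> p x" using * exp_ge_add_one_self[of "- \<delta> / 2"] \<delta>_pos by simp
  have "p x \<le> a / \<delta> / 1"
    unfolding p using a_pos \<delta>_pos d by (intro divide_left_mono) auto
  also have "\<dots> \<le> 1 + \<delta>" using a_le \<delta>_pos by (simp add: divide_le_eq mult.commute)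
  finally show "p x \<le> 1 + \<delta>" .
qed

lemma p_pos: "x \<in> {0..1} \<Longrightarrow> 0 < p x"
  using p_bounds(1)[of x] exp_gt_zero[of "- \<delta> / 2"] by linarith

lemma G_half: "G (1/2) = 1/2"
  using \<delta>_pos a_half by (simp add: G_def)

lemma G_0: "G 0 = 0" and G_1: "G 1 = 1"
  by (simp_all add: G_def)

text \<open>The two-sided derivative exists at 0 and 1 because both formulas make sense slightly
  beyond \<open>{0..1}\<close>. At 1/2 the one-sided derivatives agree, but \<open>p\<close> has a
  corner there, so \<open>G\<close> is C^1 and not C^2.\<close>

lemma G_deriv:
  assumes "x \<in> {0..1}"
  shows "(G has_real_derivative p x) (at x)"
proof -
  have l: "((\<lambda>x. ln (1 + a * x) / \<delta>) has_real_derivative p x) (at x within S)"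
    if "0 \<le> x" "x \<le> 1/2" for x S
  proof -
    have "0 < 1 + a * x" using that a_pos by (intro add_pos_nonneg) auto
    moreover have "p x = a / (1 + a * x) / \<delta>" using that by (simp add: p_def min_def)
    ultimately show ?thesis
      using \<delta>_pos by (auto intro!: derivative_eq_intros)
  qed
  have r: "((\<lambda>x. 1 - ln (1 + a * (1 - x)) / \<delta>) has_real_derivative p x) (at x within S)"
    if "x \<le> 1" "1/2 \<le> x" for x S
  proof -
    have "0 < 1 + a * (1 - x)" using that a_pos by (intro add_pos_nonneg) auto
    moreover have "p x = a / (1 + a * (1 - x)) / \<delta>" using that by (simp add: p_def min_def)
    ultimately show ?thesis
      using \<delta>_pos by (auto intro!: derivative_eq_intros)
  qed
  have eql: "G y = ln (1 + a * y) / \<delta>" if "y \<le> 1/2" for y using that by (simp add: G_def)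
  have eqr: "G y = 1 - ln (1 + a * (1 - y)) / \<delta>" if "1/2 \<le> y" for y
  proof (cases "y = 1/2")
    case True
    show ?thesis unfolding True using \<delta>_pos a_half by (simp add: G_def)
  qed (use that in \<open>simp add: G_def\<close>)
  consider "x < 1/2" | "x = 1/2" | "1/2 < x" by linarith
  then show ?thesis
  proof cases
    case 1
    have "(G has_real_derivative p x) (at x) \<longleftrightarrow> ((\<lambda>x. ln (1 + a * x) / \<delta>) has_real_derivative p x) (at x)"
      using 1 by (intro DERIV_cong_ev eventually_mono[OF eventually_nhds_in_open[of "{..<1/2}"]])
        (auto simp: eql)
    then show ?thesis using l[of x] 1 assms by simp
  next
    case 3
    have "(G has_real_derivative p x) (at x) \<longleftrightarrow>
        ((\<lambda>x. 1 - ln (1 + a * (1 - x)) / \<delta>) has_real_derivative p x) (at x)"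
      using 3 by (intro DERIV_cong_ev eventually_mono[OF eventually_nhds_in_open[of "{1/2<..}"]])
        (auto simp: eqr)
    then show ?thesis using r[of x] 3 assms by simp
  next
    case 2
    show ?thesis
    proof (rule has_real_derivative_split)
      show "(G has_real_derivative p x) (at x within {..x})"
        by (rule has_field_derivative_transform_within[OF l[of x "{..x}"] zero_less_one]) (use 2 eql in auto)
      show "(G has_real_derivative p x) (at x within {x..})"
        by (rule has_field_derivative_transform_within[OF r[of x "{x..}"] zero_less_one]) (use 2 eqr in auto)
    qed
  qed
qed

lemma G_diff_bounds:
  assumes "0 \<le> x" "x \<le> y" "y \<le> 1"
  shows "exp (- \<delta> / 2) * (y - x) \<le> G y - G x" "G y - G x \<le> (1 + \<delta>) * (y - x)"
proof -
  have "exp (- \<delta> / 2) * (y - x) \<le> G y - G x \<and> G y - G x \<le> (1 + \<delta>) * (y - x)"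
  proof (cases "x = y")
    case False
    then obtain z where z: "x < z" "z < y" "G y - G x = (y - x) * p z"
      using MVT2[of x y G p] G_deriv assms by force
    then show ?thesis
      using p_bounds[of z] assms by (simp add: mult.commute mult_left_mono)
  qed simp
  then show "exp (- \<delta> / 2) * (y - x) \<le> G y - G x" "G y - G x \<le> (1 + \<delta>) * (y - x)" by auto
qed

lemma G_less:
  assumes "0 \<le> x" "x < y" "y \<le> 1"
  shows "G x < G y"
proof -
  have "0 < exp (- \<delta> / 2) * (y - x)" using assms by simp
  then show ?thesis using G_diff_bounds(1)[of x y] assms by linarith
qed

lemma G_le: "0 \<le> x \<Longrightarrow> x \<le> y \<Longrightarrow> y \<le> 1 \<Longrightarrow> G x \<le> G y"
  using G_less[of x y] by (cases "x = y") auto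

lemma G_in: "x \<in> {0..1} \<Longrightarrow> G x \<in> {0..1}"
  using G_le[of 0 x] G_le[of x 1] unfolding G_0 G_1 by simp

lemma branch_in: "x \<in> {0..1} \<Longrightarrow> branch b x \<in> {0..1}"
  using G_in[of x] by (cases b) (auto simp: branch_def)

lemma branch_deriv: "x \<in> {0..1} \<Longrightarrow> (branch b has_real_derivative p x / 2) (at x)"
  unfolding branch_def by (auto intro!: derivative_eq_intros G_deriv)

lemma cumul_left:
  assumes "0 \<le> u" "u \<le> 1/2"
  shows "cumul \<delta> u = exp (- \<delta> / 4) * (exp (\<delta> * u) - 1) / \<delta>"
proof -
  let ?F = "\<lambda>t. exp (\<delta> * (t - 1/4)) / \<delta>"
  have "((\<lambda>t. exp (\<delta> * (t - 1/4))) has_integral (?F u - ?F 0)) {0..u}"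
    using assms \<delta>_pos
    by (intro fundamental_theorem_of_calculus)
       (auto intro!: derivative_eq_intros simp flip: has_real_derivative_iff_has_vector_derivative)
  \<comment> \<open>At \<open>t = 1/2\<close> the other formula for \<open>Phi\<close> applies, with
    the same value 1/4.\<close>
  moreover have "exp (\<delta> * Phi t) = exp (\<delta> * (t - 1/4))" if "t \<in> {0..u}" for t
    using that assms Phi_Icc(1)[of t] Phi_Icc(2)[of t] by (cases "t < 1/2") auto
  ultimately have "((\<lambda>t. exp (\<delta> * Phi t)) has_integral (?F u - ?F 0)) {0..u}"
    by (metis (no_types, lifting) has_integral_eq)
  then have "cumul \<delta> u = ?F u - ?F 0"
    using exp_Phi_has_integral[of 0 u \<delta>] assms by (simp add: cumul_0 has_integral_unique)
  also have "?F u = exp (- \<delta> / 4) * exp (\<delta> * u) / \<delta>"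
    by (simp add: algebra_simps flip: exp_add)
  also have "?F 0 = exp (- \<delta> / 4) / \<delta>" by simp
  finally show ?thesis by (simp add: diff_divide_distrib algebra_simps)
qed

lemma cumul_right:
  assumes "1/2 \<le> u" "u \<le> 1"
  shows "cumul \<delta> 1 - cumul \<delta> u = exp (- \<delta> / 4) * (exp (\<delta> * (1 - u)) - 1) / \<delta>"
proof -
  let ?F = "\<lambda>t. - exp (\<delta> * (3/4 - t)) / \<delta>"
  have "((\<lambda>t. exp (\<delta> * (3/4 - t))) has_integral (?F 1 - ?F u)) {u..1}"
    using assms \<delta>_pos
    by (intro fundamental_theorem_of_calculus)
       (auto intro!: derivative_eq_intros simp flip: has_real_derivative_iff_has_vector_derivative)
  \<comment> \<open>At \<open>t = 1\<close> periodicity gives \<open>Phi 1 = Phi 0 = - 1/4\<close>,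
    which is the value of \<open>3/4 - t\<close> there.\<close>
  moreover have "exp (\<delta> * Phi t) = exp (\<delta> * (3/4 - t))" if "t \<in> {u..1}" for t
    using that assms Phi_Icc(2)[of t] by (cases "t < 1") (auto simp: Phi_def)
  ultimately have "((\<lambda>t. exp (\<delta> * Phi t)) has_integral (?F 1 - ?F u)) {u..1}"
    by (metis (no_types, lifting) has_integral_eq)
  then have "cumul \<delta> 1 - cumul \<delta> u = ?F 1 - ?F u"
    using exp_Phi_has_integral[of u 1 \<delta>] assms by (simp add: has_integral_unique)
  also have "?F u = - exp (- \<delta> / 4) * exp (\<delta> * (1 - u)) / \<delta>"
    by (simp add: algebra_simps flip: exp_add)
  also have "?F 1 = - exp (- \<delta> / 4) / \<delta>" by simp
  finally show ?thesis by (simp add: diff_divide_distrib algebra_simps)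
qed

lemma cumul_1: "cumul \<delta> 1 = exp (- \<delta> / 4) * a / \<delta>"
  using cumul_left[of "1/2"] cumul_right[of "1/2"] \<delta>_pos by (simp add: a_def field_simps)

lemma cumul_G:
  assumes "y \<in> {0..1}"
  shows "cumul \<delta> (G y) = y * cumul \<delta> 1"
proof (cases "y \<le> 1/2")
  case True
  have G: "0 \<le> G y" "G y \<le> 1/2"
    using G_le[of 0 y] G_le[of y "1/2"] True assms unfolding G_0 G_half by auto
  have "0 < 1 + a * y" using a_pos assms by (intro add_pos_nonneg) auto
  then have "exp (\<delta> * G y) = 1 + a * y"
    using True \<delta>_pos by (simp add: G_def)
  then show ?thesis using cumul_left[OF G] by (simp add: cumul_1)
next
  case False
  have G: "1/2 \<le> G y" "G y \<le> 1"
    using G_le[of "1/2" y] G_le[of y 1] False assms unfolding G_1 G_half by auto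
  have "0 < 1 + a * (1 - y)" using a_pos assms by (intro add_pos_nonneg) auto
  then have "exp (\<delta> * (1 - G y)) = 1 + a * (1 - y)"
    using False \<delta>_pos by (simp add: G_def)
  then have "cumul \<delta> 1 - cumul \<delta> (G y) = (1 - y) * cumul \<delta> 1"
    using cumul_right[OF G] by (simp add: cumul_1)
  then show ?thesis by (simp add: algebra_simps)
qed

lemma f_branch:
  assumes "y \<in> {0..1}"
  shows "f (branch b y) = y + of_bool b"
proof -
  have F: "f (G y / 2) = y"
    using cumul_G[OF assms] cumul_1_pos[of \<delta>] by (simp add: f_delta_eq)
  show ?thesis
    using F f_delta_add_half[of \<delta> "G y / 2"] by (cases b) (simp_all add: branch_def add_divide_distrib)
qed

text \<open>The first letter acts first, so prepending a letter composes with a branch on the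
  inside. The recursions for \<open>word_deriv\<close>, \<open>nonlin\<close> and
  \<open>wave\<close> peel off letters in this order.\<close>

primrec word_map :: "bool list \<Rightarrow> real \<Rightarrow> real" where
  "word_map [] x = x"
| "word_map (b # w) x = word_map w (branch b x)"

primrec word_deriv :: "bool list \<Rightarrow> real \<Rightarrow> real" where
  "word_deriv [] x = 1"
| "word_deriv (b # w) x = word_deriv w (branch b x) * (p x / 2)"

text \<open>\<open>- \<delta> * nonlin w\<close> is the logarithmic derivative of \<open>word_deriv w\<close>; for \<open>p = 1\<close> it is the binary
  expansion with signs as digits, the first given by the half containing \<open>x\<close> and the others by \<open>w\<close>
  without its last letter.\<close>

primrec nonlin :: "bool list \<Rightarrow> real \<Rightarrow> real" where
  "nonlin [] x = 0"
| "nonlin (b # w) x = p x * ((if x < 1/2 then 1 else - 1) + nonlin w (branch b x) / 2)"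

text \<open>The open halves are the pieces on which \<open>p\<close> is smooth. A branch maps either
  of them into the half named by its letter, so no backward orbit that starts in a half meets the
  corner of \<open>p\<close>.\<close>

definition half :: "bool \<Rightarrow> real set" where
  "half b = (if b then {1/2<..<1} else {0<..<1/2})"

lemma half_subset: "x \<in> half c \<Longrightarrow> x \<in> {0..1}"
  by (auto simp: half_def split: if_splits)

lemma branch_half:
  assumes "x \<in> half c"
  shows "branch b x \<in> half b"
  using G_less[of 0 x] G_less[of x 1] assms by (auto simp: half_def branch_def G_0 G_1 split: if_splits)

lemma word_map_deriv:
  "x \<in> {0..1} \<Longrightarrow> (word_map w has_real_derivative word_deriv w x) (at x)"
proof (induction w arbitrary: x)
  case (Cons b w)
  have "((\<lambda>x. word_map w (branch b x)) has_real_derivative word_deriv w (branch b x) * (p x / 2)) (at x)"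
    by (rule DERIV_chain2[OF Cons.IH branch_deriv]) (use Cons.prems branch_in in auto)
  then show ?case by (simp add: fun_eq_iff)
next
  case Nil
  have "word_map [] = (\<lambda>x. x)" by (simp add: fun_eq_iff)
  then show ?case by simp
qed

text \<open>On each half \<open>1 / p\<close> is affine with slope \<delta> or -\<delta>, because
  \<open>Phi\<close> is piecewise linear. Hence \<open>p\<close> solves a Riccati equation, and its
  logarithmic derivative is again a multiple of \<open>p\<close>.\<close>

lemma p_deriv:
  assumes "x \<in> half c"
  shows "(p has_real_derivative - \<delta> * (if x < 1/2 then 1 else - 1) * (p x)\<^sup>2) (at x)"
proof (cases c)
  case False
  then have x: "0 < x" "x < 1/2" using assms by (auto simp: half_def)
  have "(p has_real_derivative - \<delta> * (p x)\<^sup>2) (at x) \<longleftrightarrow>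
      ((\<lambda>x. a / (\<delta> * (1 + a * x))) has_real_derivative - \<delta> * (p x)\<^sup>2) (at x)"
    using x by (intro DERIV_cong_ev eventually_mono[OF eventually_nhds_in_open[of "{..<1/2}"]])
      (auto simp: p_def min_def)
  moreover have "0 < 1 + a * x" using a_pos x by (intro add_pos_nonneg) auto
  then have "((\<lambda>x. a / (\<delta> * (1 + a * x))) has_real_derivative - \<delta> * (p x)\<^sup>2) (at x)"
  proof -
    define y where "y = 1 + a * x"
    have y: "0 < y" "p x = a / (\<delta> * y)"
      using \<open>0 < 1 + a * x\<close> x by (auto simp: y_def p_def min_def)
    have "((\<lambda>x. a / (\<delta> * (1 + a * x))) has_real_derivative
        (0 * (\<delta> * y) - a * (\<delta> * a)) / ((\<delta> * y) * (\<delta> * y))) (at x)"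
      using y(1) \<delta>_pos unfolding y_def by (auto intro!: derivative_eq_intros)
    also have "(0 * (\<delta> * y) - a * (\<delta> * a)) / ((\<delta> * y) * (\<delta> * y)) = - \<delta> * (p x)\<^sup>2"
      using y \<delta>_pos by (simp add: power2_eq_square)
    finally show ?thesis .
  qed
  ultimately show ?thesis using x by simp
next
  case True
  then have x: "1/2 < x" "x < 1" using assms by (auto simp: half_def)
  have "(p has_real_derivative \<delta> * (p x)\<^sup>2) (at x) \<longleftrightarrow>
      ((\<lambda>x. a / (\<delta> * (1 + a * (1 - x)))) has_real_derivative \<delta> * (p x)\<^sup>2) (at x)"
    using x by (intro DERIV_cong_ev eventually_mono[OF eventually_nhds_in_open[of "{1/2<..}"]])
      (auto simp: p_def min_def)
  moreover have "0 < 1 + a * (1 - x)" using a_pos x by (intro add_pos_nonneg) auto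
  then have "((\<lambda>x. a / (\<delta> * (1 + a * (1 - x)))) has_real_derivative \<delta> * (p x)\<^sup>2) (at x)"
  proof -
    define y where "y = 1 + a * (1 - x)"
    have y: "0 < y" "p x = a / (\<delta> * y)"
      using \<open>0 < 1 + a * (1 - x)\<close> x by (auto simp: y_def p_def min_def)
    have "((\<lambda>x. a / (\<delta> * (1 + a * (1 - x)))) has_real_derivative
        (0 * (\<delta> * y) - a * (\<delta> * - a)) / ((\<delta> * y) * (\<delta> * y))) (at x)"
      using y(1) \<delta>_pos unfolding y_def by (auto intro!: derivative_eq_intros)
    also have "(0 * (\<delta> * y) - a * (\<delta> * - a)) / ((\<delta> * y) * (\<delta> * y)) = \<delta> * (p x)\<^sup>2"
      using y \<delta>_pos by (simp add: power2_eq_square)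
    finally show ?thesis .
  qed
  ultimately show ?thesis using x by simp
qed

text \<open>Logarithmic differentiation of the product: the factor \<open>p x / 2\<close>
  contributes \<open>- \<delta> * ?s * p x\<close>, and the inner factor contributes, by the chain
  rule, its own logarithmic derivative times \<open>p x / 2\<close>. The recursion of
  \<open>nonlin\<close> collects exactly these two terms.\<close>

lemma word_deriv_deriv:
  "x \<in> half c \<Longrightarrow> (word_deriv w has_real_derivative - \<delta> * nonlin w x * word_deriv w x) (at x)"
proof (induction w arbitrary: x c)
  case (Cons b w)
  let ?s = "if x < 1/2 then 1 else - 1 :: real"
  have "((\<lambda>x. word_deriv w (branch b x)) has_real_derivative
      (- \<delta> * nonlin w (branch b x) * word_deriv w (branch b x)) * (p x / 2)) (at x)"
    by (rule DERIV_chain2[OF Cons.IH branch_deriv])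
       (use Cons.prems branch_half half_subset in blast)+
  from DERIV_mult[OF this DERIV_cdivide[OF p_deriv[OF Cons.prems], of 2]]
  have "((\<lambda>x. word_deriv (b # w) x) has_real_derivative
      (- \<delta> * nonlin w (branch b x) * word_deriv w (branch b x)) * (p x / 2) * (p x / 2)
      + - \<delta> * ?s * (p x)\<^sup>2 / 2 * word_deriv w (branch b x)) (at x)"
    by simp
  also have "(- \<delta> * nonlin w (branch b x) * word_deriv w (branch b x)) * (p x / 2) * (p x / 2)
      + - \<delta> * ?s * (p x)\<^sup>2 / 2 * word_deriv w (branch b x)
      = - \<delta> * nonlin (b # w) x * word_deriv (b # w) x"
    unfolding nonlin.simps word_deriv.simps by algebra
  finally show ?case .
next
  case Nil
  have "word_deriv [] = (\<lambda>x. 1)" by (simp add: fun_eq_iff)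
  then show ?case by simp
qed

text \<open>The lower bound 1/3 for \<open>p x / 2\<close> is crude; it only affects the base of the
  exponential in the final count.\<close>

lemma word_deriv_bounds:
  "x \<in> {0..1} \<Longrightarrow> (1/3) ^ length w \<le> word_deriv w x \<and> word_deriv w x \<le> ((1 + \<delta>) / 2) ^ length w"
proof (induction w arbitrary: x)
  case (Cons b w)
  have p: "1/3 \<le> p x / 2" "p x / 2 \<le> (1 + \<delta>) / 2"
    using p_bounds[OF Cons.prems] \<delta>_le \<delta>_pos by auto
  have IH: "(1/3) ^ length w \<le> word_deriv w (branch b x)"
    "word_deriv w (branch b x) \<le> ((1 + \<delta>) / 2) ^ length w"
    using Cons.IH[OF branch_in[OF Cons.prems]] by auto
  then have "0 \<le> word_deriv w (branch b x)" by (meson order_trans zero_le_power zero_le_divide_1_iff zero_le_numeral)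
  then have "(1/3) ^ length w * (1/3) \<le> word_deriv w (branch b x) * (p x / 2)"
    "word_deriv w (branch b x) * (p x / 2) \<le> ((1 + \<delta>) / 2) ^ length w * ((1 + \<delta>) / 2)"
    using IH p \<delta>_pos by (intro mult_mono; simp)+
  then show ?case by (simp add: mult.commute)
qed simp

lemma word_deriv_le_1: "x \<in> {0..1} \<Longrightarrow> word_deriv w x \<le> 1"
  using word_deriv_bounds[of x w] power_le_one[of "(1 + \<delta>) / 2" "length w"] \<delta>_pos \<delta>_le by auto

lemma word_deriv_pos: "x \<in> {0..1} \<Longrightarrow> 0 < word_deriv w x"
  using word_deriv_bounds[of x w] zero_less_power[of "1/3 :: real" "length w"] by linarith

text \<open>The number 2 is the sum \<open>1 + 1/2 + 1/4 + ...\<close> of an expansion with equal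
  signs; adding \<open>5 * \<delta>\<close> gives a bound \<open>N\<close> that dominates
  \<open>(1 + \<delta>) * (1 + N / 2)\<close> and so passes through the recursion.\<close>

lemma nonlin_bound: "x \<in> {0..1} \<Longrightarrow> \<bar>nonlin w x\<bar> \<le> 2 + 5 * \<delta>"
proof (induction w arbitrary: x)
  case (Cons b w)
  have N: "\<bar>nonlin w (branch b x)\<bar> \<le> 2 + 5 * \<delta>" by (rule Cons.IH[OF branch_in[OF Cons.prems]])
  have "\<bar>nonlin (b # w) x\<bar> = p x * \<bar>(if x < 1/2 then 1 else - 1) + nonlin w (branch b x) / 2\<bar>"
    using p_pos[OF Cons.prems] by (simp add: abs_mult)
  also have "\<dots> \<le> (1 + \<delta>) * (2 + 5/2 * \<delta>)"
    using p_bounds(3)[OF Cons.prems] \<delta>_pos N by (intro mult_mono) auto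
  also have "\<dots> \<le> 2 + 5 * \<delta>"
    using \<delta>_pos \<delta>_le mult_right_mono[of \<delta> "1/100" \<delta>] by (simp add: algebra_simps)
  finally show ?case .
qed (use \<delta>_pos in simp)

text \<open>The leading sign outweighs the tail, half of which is at most
  \<open>1 + 5/2 * \<delta>\<close>. So the position of \<open>x\<close> determines the sign of the
  nonlinearity up to an error of order \<delta>.\<close>

lemma nonlin_sign:
  assumes "x \<in> half c"
  shows "\<not> c \<Longrightarrow> - 3 * \<delta> \<le> nonlin w x" "c \<Longrightarrow> nonlin w x \<le> 3 * \<delta>"
proof -
  have "(\<not> c \<longrightarrow> - 3 * \<delta> \<le> nonlin w x) \<and> (c \<longrightarrow> nonlin w x \<le> 3 * \<delta>)"
  proof (cases w)
    case (Cons b v)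
    have x: "x \<in> {0..1}" by (rule half_subset[OF assms])
    have N: "\<bar>nonlin v (branch b x)\<bar> \<le> 2 + 5 * \<delta>" by (rule nonlin_bound[OF branch_in[OF x]])
    have le: "p x * (5/2 * \<delta>) \<le> 3 * \<delta>"
    proof -
      have "p x * (5/2 * \<delta>) \<le> (6/5) * (5/2 * \<delta>)"
        using p_bounds(3)[OF x] \<delta>_le \<delta>_pos by (intro mult_right_mono) auto
      then show ?thesis by simp
    qed
    have "p x * (- (5/2 * \<delta>)) \<le> p x * (1 + nonlin v (branch b x) / 2)"
      "p x * (- 1 + nonlin v (branch b x) / 2) \<le> p x * (5/2 * \<delta>)"
      using N p_pos[OF x] by (intro mult_left_mono; simp add: abs_le_iff)+
    then show ?thesis
      using assms le by (auto simp: Cons half_def)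
  qed (use \<delta>_pos in simp)
  then show "\<not> c \<Longrightarrow> - 3 * \<delta> \<le> nonlin w x" "c \<Longrightarrow> nonlin w x \<le> 3 * \<delta>" by auto
qed

lemma branch_lipschitz:
  assumes "x \<in> {0..1}" "y \<in> {0..1}"
  shows "\<bar>branch b x - branch b y\<bar> \<le> (1 + \<delta>) / 2 * \<bar>x - y\<bar>"
proof -
  have "\<bar>branch b x - branch b y\<bar> \<le> (1 + \<delta>) / 2 * \<bar>x - y\<bar>" if "0 \<le> x" "x \<le> y" "y \<le> 1" for x y
  proof -
    have "0 \<le> exp (- \<delta> / 2) * (y - x)" using that by simp
    then have "0 \<le> G y - G x" "G y - G x \<le> (1 + \<delta>) * (y - x)" using G_diff_bounds[OF that] by linarith+
    moreover have "branch b y - branch b x = (G y - G x) / 2" by (simp add: branch_def field_simps)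
    moreover have "\<bar>x - y\<bar> = y - x" using that by simp
    ultimately show ?thesis by (simp add: abs_minus_commute)
  qed
  from this[of x y] this[of y x] assms show ?thesis
    by (cases "x \<le> y") (auto simp: abs_minus_commute)
qed

lemma p_lipschitz:
  assumes "x \<in> half c" "y \<in> half c"
  shows "\<bar>p x - p y\<bar> \<le> 2 * \<delta> * \<bar>x - y\<bar>"
proof -
  have "convex (half c)" by (simp add: half_def)
  moreover have "norm (- \<delta> * (if z < 1/2 then 1 else - 1) * (p z)\<^sup>2) \<le> 2 * \<delta>" if "z \<in> half c" for z
  proof -
    have "(p z)\<^sup>2 \<le> (101/100)\<^sup>2"
      using p_bounds(3)[OF half_subset[OF that]] p_pos[OF half_subset[OF that]] \<delta>_le by (intro power_mono) auto
    then have "\<delta> * (p z)\<^sup>2 \<le> \<delta> * 2" using \<delta>_pos by (intro mult_left_mono) (auto simp: power2_eq_square)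
    then show ?thesis using \<delta>_pos by (simp add: abs_mult)
  qed
  ultimately have "norm (p x - p y) \<le> 2 * \<delta> * norm (x - y)"
    using assms has_field_derivative_at_within[OF p_deriv]
    by (intro field_differentiable_bound[where f=p and S="half c"
          and f'="\<lambda>z. - \<delta> * (if z < 1/2 then 1 else - 1) * (p z)\<^sup>2"])
  then show ?thesis by simp
qed

text \<open>The signs agree at both points, so only \<open>p\<close> and the base point of the tail
  vary. The constant 1 reproduces itself: the tail contributes about a quarter of it, the variation
  of \<open>p\<close> at most \<open>6 * \<delta>\<close>. A separation of two nonlinearities at one
  point thus persists on a short interval.\<close>

lemma nonlin_lipschitz:
  "x \<in> half c \<Longrightarrow> y \<in> half c \<Longrightarrow> \<bar>nonlin w x - nonlin w y\<bar> \<le> \<bar>x - y\<bar>"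
proof (induction w arbitrary: x y c)
  case (Cons b w)
  have xy: "x \<in> {0..1}" "y \<in> {0..1}" using Cons.prems half_subset by blast+
  define s :: real where "s = (if c then - 1 else 1)"
  have s: "(if x < 1/2 then 1 else - 1) = s" "(if y < 1/2 then 1 else - 1) = s" "\<bar>s\<bar> = 1"
    using Cons.prems by (auto simp: s_def half_def split: if_splits)
  let ?X = "nonlin w (branch b x)" and ?Y = "nonlin w (branch b y)"
  have "nonlin (b # w) x - nonlin (b # w) y = (p x - p y) * (s + ?X / 2) + p y * ((?X - ?Y) / 2)"
    unfolding nonlin.simps s by (simp add: field_simps)
  also have "\<bar>\<dots>\<bar> \<le> \<bar>p x - p y\<bar> * \<bar>s + ?X / 2\<bar> + p y * (\<bar>?X - ?Y\<bar> / 2)"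
    using p_pos[OF xy(2)] by (intro order_trans[OF abs_triangle_ineq]) (simp add: abs_mult)
  also have "\<dots> \<le> (2 * \<delta> * \<bar>x - y\<bar>) * 3 + (1 + \<delta>) * ((1 + \<delta>) / 2 * \<bar>x - y\<bar> / 2)"
  proof (intro add_mono mult_mono divide_right_mono)
    show "\<bar>s + ?X / 2\<bar> \<le> 3" using nonlin_bound[OF branch_in[OF xy(1)], of w b] s(3) \<delta>_le by linarith
    show "\<bar>?X - ?Y\<bar> \<le> (1 + \<delta>) / 2 * \<bar>x - y\<bar>"
      by (rule order_trans[OF Cons.IH branch_lipschitz[OF xy]]) (use Cons.prems branch_half in auto)
  qed (use p_lipschitz[OF Cons.prems] p_bounds[OF xy(2)] \<delta>_pos in auto)
  also have "\<dots> = (6 * \<delta> + (1 + \<delta>)\<^sup>2 / 4) * \<bar>x - y\<bar>" by (simp add: algebra_simps power2_eq_square)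
  also have "\<dots> \<le> 1 * \<bar>x - y\<bar>"
  proof (rule mult_right_mono)
    have "(1 + \<delta>)\<^sup>2 \<le> (101/100)\<^sup>2" using \<delta>_pos \<delta>_le by (intro power_mono) auto
    then show "6 * \<delta> + (1 + \<delta>)\<^sup>2 / 4 \<le> 1" using \<delta>_le by (simp add: power2_eq_square)
  qed simp
  finally show ?case by simp
qed simp

subsection \<open>Distribution of the nonlinearity\<close>

text \<open>At each letter the windows of the two values of the letter overlap only near \<open>0\<close>, and there
  the next letter is forced; so two letters leave at most two of four continuations.\<close>

lemma card_nonlin_window:
  assumes "x \<in> half c" "0 \<le> l" "5 ^ k * l \<le> 1/4"
  shows "card {w. length w = 2 * k \<and> \<bar>nonlin w x - t\<bar> \<le> l} \<le> 2 ^ k"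
  using assms
proof (induction k arbitrary: x c t l)
  case 0
  have "{w. length w = 2 * 0 \<and> \<bar>nonlin w x - t\<bar> \<le> l} \<subseteq> {[]}" by auto
  then have "card {w. length w = 2 * 0 \<and> \<bar>nonlin w x - t\<bar> \<le> l} \<le> card {[] :: bool list}"
    by (intro card_mono) auto
  then show ?case by simp
next
  case (Suc k)
  have x01: "x \<in> {0..1}" by (rule half_subset[OF Suc.prems(1)])
  define s :: real where "s = (if x < 1/2 then 1 else - 1)"
  \<comment> \<open>The first sign is dictated by \<open>x\<close>. The letter \<open>b\<close>
    enters only through the leading sign at \<open>branch b x\<close>, so the target
    \<open>t'\<close> for the tail is the same for both letters.\<close>
  define t' where "t' = 2 * (t / p x - s)"
  define sg :: "bool \<Rightarrow> real" where "sg b = (if b then - 1 else 1)" for b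
  define l' where "l' = 2 * l / p x"
  have "5 * l \<le> 5 ^ k * (5 * l)"
    using Suc.prems(2) mult_right_mono[of 1 "5 ^ k" "5 * l"] by simp
  then have l: "l \<le> 1/20" using Suc.prems(3) by simp
  have px: "99/100 \<le> p x" "0 < p x" using p_bounds(2)[OF x01] \<delta>_le by auto
  have l': "0 \<le> l'" "l' \<le> 1/9"
    using px l Suc.prems(2) by (auto simp: l'_def divide_le_eq)
  have y1: "branch b x \<in> half b" "branch b x \<in> {0..1}" for b
    using branch_half[OF Suc.prems(1)] branch_in[OF x01] by auto
  have p1: "99/100 \<le> p (branch b x)" "0 < p (branch b x)" "p (branch b x) \<le> 101/100" for b
    using p_bounds[OF y1(2), of b] \<delta>_le by auto
  have sg: "(if branch b x < 1/2 then 1 else - 1) = sg b" for b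
    using y1(1)[of b] by (auto simp: half_def sg_def split: if_splits)
  have step1: "\<bar>nonlin v (branch b x) - t'\<bar> \<le> l'" if "\<bar>nonlin (b # v) x - t\<bar> \<le> l" for b v
  proof -
    have "nonlin (b # v) x - t = p x / 2 * (nonlin v (branch b x) - t')"
      using px by (simp add: t'_def s_def field_simps)
    then have "p x / 2 * \<bar>nonlin v (branch b x) - t'\<bar> \<le> l"
      using that px by (simp add: abs_mult)
    then show ?thesis using px by (simp add: l'_def field_simps)
  qed
  \<comment> \<open>Two letters enlarge the window by \<open>4 / (p x * p (branch b x))\<close>,
    which is below 5; this is the origin of the scale \<open>5 ^ k\<close>.\<close>
  have step2: "\<bar>nonlin v (branch c (branch b x)) - 2 * (t' / p (branch b x) - sg b)\<bar> \<le> 5 * l"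
    if "\<bar>nonlin (b # c # v) x - t\<bar> \<le> l" for b c v
  proof -
    let ?q = "p (branch b x)"
    have "nonlin (c # v) (branch b x) - t'
        = ?q / 2 * (nonlin v (branch c (branch b x)) - 2 * (t' / ?q - sg b))"
      unfolding nonlin.simps sg using p1(2)[of b] by (simp add: field_simps)
    then have "?q / 2 * \<bar>nonlin v (branch c (branch b x)) - 2 * (t' / ?q - sg b)\<bar> \<le> l'"
      using step1[OF that] p1(2)[of b] by (simp add: abs_mult)
    then have "\<bar>nonlin v (branch c (branch b x)) - 2 * (t' / ?q - sg b)\<bar> \<le> 2 * l' / ?q"
      using p1(2)[of b] by (simp add: field_simps)
    also have "\<dots> = 4 * l / (p x * ?q)" by (simp add: l'_def)
    also have "\<dots> \<le> 4 * l / ((99/100) * (99/100))"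
      using px p1[of b] Suc.prems(2) by (intro divide_left_mono mult_mono) auto
    also have "\<dots> \<le> 5 * l" using Suc.prems(2) by simp
    finally show ?thesis .
  qed
  define W where "W b c = {v. length v = 2 * k \<and> \<bar>nonlin (b # c # v) x - t\<bar> \<le> l}" for b c
  have W: "card (W b c) \<le> 2 ^ k" for b c
  proof -
    have "W b c \<subseteq> {v. length v = 2 * k \<and>
        \<bar>nonlin v (branch c (branch b x)) - 2 * (t' / p (branch b x) - sg b)\<bar> \<le> 5 * l}"
      using step2 by (auto simp: W_def)
    then have "card (W b c) \<le> card {v. length v = 2 * k \<and>
        \<bar>nonlin v (branch c (branch b x)) - 2 * (t' / p (branch b x) - sg b)\<bar> \<le> 5 * l}"
      by (intro card_mono finite_words)
    also have "\<dots> \<le> 2 ^ k"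
      using Suc.prems by (intro Suc.IH[OF branch_half[OF y1(1)]]) auto
    finally show ?thesis .
  qed
  \<comment> \<open>The threshold 1/7 lies just above \<open>1/9 + 3/100\<close>, a bound for
    \<open>l' + 3 * \<delta>\<close>.\<close>
  have sign1: "b \<Longrightarrow> t' \<le> 1/7" "\<not> b \<Longrightarrow> - (1/7) \<le> t'" if "W b c \<noteq> {}" for b c
  proof -
    from that obtain v where "\<bar>nonlin (b # c # v) x - t\<bar> \<le> l" by (auto simp: W_def)
    from step1[OF this] have "\<bar>nonlin (c # v) (branch b x) - t'\<bar> \<le> l'" .
    moreover have "\<not> b \<Longrightarrow> - 3 * \<delta> \<le> nonlin (c # v) (branch b x)" "b \<Longrightarrow> nonlin (c # v) (branch b x) \<le> 3 * \<delta>"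
      using nonlin_sign[OF y1(1)] by blast+
    ultimately show "b \<Longrightarrow> t' \<le> 1/7" "\<not> b \<Longrightarrow> - (1/7) \<le> t'" using l' \<delta>_le by linarith+
  qed
  \<comment> \<open>A value near 0 with leading sign \<open>sg b\<close> needs a tail of the
    opposite sign, and the sign of that tail is set by \<open>c\<close>.\<close>
  have sign2: "b \<noteq> c" if "W b c \<noteq> {}" and t': "\<bar>t'\<bar> \<le> 1/7" for b c
  proof -
    from that(1) obtain v where v: "\<bar>nonlin (b # c # v) x - t\<bar> \<le> l"
      unfolding W_def by blast
    let ?n = "nonlin v (branch c (branch b x))"
    have n: "\<not> c \<Longrightarrow> - 3 * \<delta> \<le> ?n" "c \<Longrightarrow> ?n \<le> 3 * \<delta>"
      using nonlin_sign[OF branch_half[OF y1(1)]] by blast+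
    define r where "r = t' / p (branch b x)"
    have "\<bar>r\<bar> \<le> (1/7) / (99/100)"
      using t' p1[of b] unfolding abs_divide r_def by (intro frac_le) auto
    then have r: "- 1/6 \<le> r" "r \<le> 1/6" by auto
    have d: "?n \<le> 2 * (r - sg b) + 5 * l" "2 * (r - sg b) - 5 * l \<le> ?n"
      using step2[OF v] unfolding r_def by linarith+
    show ?thesis
    proof
      assume "b = c"
      then show False
      proof (cases c)
        case True
        then show False using d(2) n(2) r \<delta>_le l \<open>b = c\<close> by (simp add: sg_def)
      next
        case False
        then show False using d(1) n(1) r \<delta>_le l \<open>b = c\<close> by (simp add: sg_def)
      qed
    qed
  qed
  have "{w. length w = 2 * Suc k \<and> \<bar>nonlin w x - t\<bar> \<le> l}
      = (\<Union>(b, c)\<in>UNIV. (\<lambda>v. b # c # v) ` W b c)"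
    unfolding W_def by (rule word_split)
  also have "\<exists>b c b' c'. (\<Union>(b, c)\<in>UNIV. (\<lambda>v. b # c # v) ` W b c)
       \<subseteq> (\<lambda>v. b # c # v) ` W b c \<union> (\<lambda>v. b' # c' # v) ` W b' c'"
  proof (cases "\<bar>t'\<bar> \<le> 1/7")
    case True
    have "(\<Union>(b, c)\<in>UNIV. (\<lambda>v. b # c # v) ` W b c)
       \<subseteq> (\<lambda>v. False # True # v) ` W False True \<union> (\<lambda>v. True # False # v) ` W True False"
    proof
      fix w assume "w \<in> (\<Union>(b, c)\<in>UNIV. (\<lambda>v. b # c # v) ` W b c)"
      then obtain b c v where w: "w = b # c # v" "v \<in> W b c" by blast
      then have "b \<noteq> c" using sign2[OF _ True, of b c] by blast
      then show "w \<in> (\<lambda>v. False # True # v) ` W False True \<union> (\<lambda>v. True # False # v) ` W True False"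
        using w by (cases b) auto
    qed
    then show ?thesis by blast
  next
    case False
    \<comment> \<open>Away from 0 the sign of \<open>t'\<close> decides the first letter.\<close>
    define d where "d \<longleftrightarrow> t' \<le> 1/7"
    have "(\<Union>(b, c)\<in>UNIV. (\<lambda>v. b # c # v) ` W b c)
       \<subseteq> (\<lambda>v. d # True # v) ` W d True \<union> (\<lambda>v. d # False # v) ` W d False"
    proof
      fix w assume "w \<in> (\<Union>(b, c)\<in>UNIV. (\<lambda>v. b # c # v) ` W b c)"
      then obtain b c v where w: "w = b # c # v" "v \<in> W b c" by blast
      then have "W b c \<noteq> {}" by blast
      from sign1[OF this] False have "b = d" unfolding d_def by (cases b) auto
      then show "w \<in> (\<lambda>v. d # True # v) ` W d True \<union> (\<lambda>v. d # False # v) ` W d False"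
        using w by (cases c) auto
    qed
    then show ?thesis by blast
  qed
  finally obtain b c b' c' where sub: "{w. length w = 2 * Suc k \<and> \<bar>nonlin w x - t\<bar> \<le> l}
       \<subseteq> (\<lambda>v. b # c # v) ` W b c \<union> (\<lambda>v. b' # c' # v) ` W b' c'" by blast
  have fin: "finite (W b c)" for b c unfolding W_def by (rule finite_words)
  have "card {w. length w = 2 * Suc k \<and> \<bar>nonlin w x - t\<bar> \<le> l}
     \<le> card ((\<lambda>v. b # c # v) ` W b c \<union> (\<lambda>v. b' # c' # v) ` W b' c')"
    by (intro card_mono sub) (simp add: fin)
  also have "\<dots> \<le> card (W b c) + card (W b' c')"
    by (intro order_trans[OF card_Un_le] add_mono card_image_le fin)
  also have "\<dots> \<le> 2 ^ Suc k" using W[of b c] W[of b' c'] by simp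
  finally show ?case .
qed

end

subsection \<open>Oscillatory integrals\<close>

text \<open>Integration by parts: \<open>cos \<phi>\<close> differs from the derivative of
  \<open>sin \<phi> / \<phi>'\<close> by \<open>sin \<phi> * \<phi>'' / \<phi>'^2\<close>. The
  second derivative is assumed in the interior only, because an endpoint may be the corner of
  \<open>p\<close>.\<close>

lemma integral_cos_bound:
  fixes \<phi> \<phi>' \<phi>'' :: "real \<Rightarrow> real"
  assumes cd: "c \<le> d" and m: "0 < m"
    and d1: "\<And>x. x \<in> {c..d} \<Longrightarrow> (\<phi> has_real_derivative \<phi>' x) (at x)"
    and cont: "continuous_on {c..d} \<phi>'"
    and d2: "\<And>x. x \<in> {c<..<d} \<Longrightarrow> (\<phi>' has_real_derivative \<phi>'' x) (at x)"
    and lower: "\<And>x. x \<in> {c..d} \<Longrightarrow> m \<le> \<bar>\<phi>' x\<bar>"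
    and upper: "\<And>x. x \<in> {c<..<d} \<Longrightarrow> \<bar>\<phi>'' x\<bar> \<le> B" and B: "0 \<le> B"
  shows "\<bar>integral {c..d} (\<lambda>x. cos (\<phi> x))\<bar> \<le> 2 / m + (d - c) * B / m\<^sup>2"
proof -
  have c\<phi>: "continuous_on {c..d} \<phi>"
    using d1 by (meson DERIV_continuous_on has_field_derivative_at_within)
  have nz: "\<phi>' x \<noteq> 0" if "x \<in> {c..d}" for x using lower[OF that] m by auto
  define F where "F x = sin (\<phi> x) / \<phi>' x" for x
  define e where "e x = sin (\<phi> x) * \<phi>'' x / (\<phi>' x)\<^sup>2" for x
  have "((\<lambda>x. cos (\<phi> x) - e x) has_integral (F d - F c)) {c..d}"
  proof (rule fundamental_theorem_of_calculus_interior[OF cd])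
    show "continuous_on {c..d} F"
      unfolding F_def using nz by (intro continuous_intros c\<phi> cont) auto
    fix x assume x: "x \<in> {c<..<d}"
    then have x': "x \<in> {c..d}" by auto
    have "(F has_real_derivative
        ((cos (\<phi> x) * \<phi>' x) * \<phi>' x - sin (\<phi> x) * \<phi>'' x) / (\<phi>' x * \<phi>' x)) (at x)"
      unfolding F_def by (intro DERIV_divide DERIV_fun_sin d1 d2 x x' nz)
    also have "((cos (\<phi> x) * \<phi>' x) * \<phi>' x - sin (\<phi> x) * \<phi>'' x) / (\<phi>' x * \<phi>' x) = cos (\<phi> x) - e x"
      using nz[OF x'] by (simp add: e_def field_simps power2_eq_square)
    finally show "(F has_vector_derivative cos (\<phi> x) - e x) (at x)"
      by (simp add: has_real_derivative_iff_has_vector_derivative)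
  qed
  note F = this
  have I: "((\<lambda>x. cos (\<phi> x)) has_integral integral {c..d} (\<lambda>x. cos (\<phi> x))) {c..d}"
    by (intro integrable_integral integrable_continuous_real continuous_intros c\<phi>)
  from has_integral_diff[OF I F] have "(e has_integral (integral {c..d} (\<lambda>x. cos (\<phi> x)) - (F d - F c))) (cbox c d)"
    by (simp add: cbox_interval)
  then have "norm (integral {c..d} (\<lambda>x. cos (\<phi> x)) - (F d - F c)) \<le> (B / m\<^sup>2) * measure lborel (cbox c d)"
  proof (rule has_integral_bound_spike_finite[where S="{c, d}", rotated 2])
    fix x assume "x \<in> cbox c d - {c, d}"
    then have x: "x \<in> {c<..<d}" "x \<in> {c..d}" by auto
    have "\<bar>sin (\<phi> x)\<bar> * \<bar>\<phi>'' x\<bar> / (\<phi>' x)\<^sup>2 \<le> 1 * B / m\<^sup>2"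
      using upper[OF x(1)] lower[OF x(2)] m B power_mono[of m "\<bar>\<phi>' x\<bar>" 2]
      by (intro frac_le mult_mono) auto
    then show "norm (e x) \<le> B / m\<^sup>2" by (simp add: e_def abs_mult)
  qed (use B in auto)
  then have E: "\<bar>integral {c..d} (\<lambda>x. cos (\<phi> x)) - (F d - F c)\<bar> \<le> (d - c) * B / m\<^sup>2"
    using cd by (simp add: mult.commute)
  have Fb: "\<bar>F x\<bar> \<le> 1 / m" if "x \<in> {c..d}" for x
    unfolding F_def abs_divide using lower[OF that] m by (intro frac_le) auto
  show ?thesis using E Fb[of c] Fb[of d] cd by simp
qed

text \<open>The \<open>r\<close>-neighbourhood of \<open>z\<close> is estimated trivially, and the
  first-derivative bound applies outside. Growth of \<open>\<phi>'\<close> away from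
  \<open>z\<close> takes the place of the usual lower bound on \<open>\<phi>''\<close>, because what
  is controlled later is the slope of the logarithm of a quotient of derivatives.\<close>

lemma integral_cos_bound_stationary:
  fixes \<phi> \<phi>' \<phi>'' :: "real \<Rightarrow> real"
  assumes z: "z \<in> {c..d}" and A: "0 < A" and r: "0 < r"
    and d1: "\<And>x. x \<in> {c..d} \<Longrightarrow> (\<phi> has_real_derivative \<phi>' x) (at x)"
    and cont: "continuous_on {c..d} \<phi>'"
    and d2: "\<And>x. x \<in> {c<..<d} \<Longrightarrow> (\<phi>' has_real_derivative \<phi>'' x) (at x)"
    and lower: "\<And>x. x \<in> {c..d} \<Longrightarrow> A * \<bar>x - z\<bar> \<le> \<bar>\<phi>' x\<bar>"
    and upper: "\<And>x. x \<in> {c<..<d} \<Longrightarrow> \<bar>\<phi>'' x\<bar> \<le> B" and B: "0 \<le> B"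
  shows "\<bar>integral {c..d} (\<lambda>x. cos (\<phi> x))\<bar> \<le> 2 * r + 2 * (2 / (A * r) + (d - c) * B / (A * r)\<^sup>2)"
proof -
  define K where "K = 2 / (A * r) + (d - c) * B / (A * r)\<^sup>2"
  have K: "0 \<le> K" using A r B z by (auto simp: K_def intro!: add_nonneg_nonneg divide_nonneg_nonneg mult_nonneg_nonneg)
  define e1 where "e1 = max c (z - r)"
  define e2 where "e2 = min d (z + r)"
  have e: "c \<le> e1" "e1 \<le> e2" "e2 \<le> d" using z r by (auto simp: e1_def e2_def)
  have c\<phi>: "continuous_on {c..d} \<phi>"
    using d1 by (meson DERIV_continuous_on has_field_derivative_at_within)
  have int: "(\<lambda>x. cos (\<phi> x)) integrable_on {s..t}" if "c \<le> s" "t \<le> d" for s t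
    using that by (intro integrable_continuous_real continuous_intros continuous_on_subset[OF c\<phi>]) auto
  \<comment> \<open>The premise \<open>s < t\<close> covers the case that the neighbourhood of
    \<open>z\<close> reaches beyond \<open>c\<close> or \<open>d\<close>, where the outer piece
    degenerates to a point.\<close>
  have away: "\<bar>integral {s..t} (\<lambda>x. cos (\<phi> x))\<bar> \<le> K"
    if st: "c \<le> s" "s \<le> t" "t \<le> d" and far: "\<And>x. s < t \<Longrightarrow> x \<in> {s..t} \<Longrightarrow> r \<le> \<bar>x - z\<bar>" for s t
  proof (cases "s = t")
    case False
    then have "s < t" using st by simp
    have "\<bar>integral {s..t} (\<lambda>x. cos (\<phi> x))\<bar> \<le> 2 / (A * r) + (t - s) * B / (A * r)\<^sup>2"
    proof (rule integral_cos_bound[where \<phi>'=\<phi>' and \<phi>''=\<phi>''])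
      show "A * r \<le> \<bar>\<phi>' x\<bar>" if "x \<in> {s..t}" for x
      proof -
        have "A * r \<le> A * \<bar>x - z\<bar>" using far[OF \<open>s < t\<close> that] A by (intro mult_left_mono) auto
        also have "\<dots> \<le> \<bar>\<phi>' x\<bar>" using that st by (intro lower) auto
        finally show ?thesis .
      qed
    qed (use st A r B d1 d2 upper in \<open>auto intro: continuous_on_subset[OF cont]\<close>)
    also have "\<dots> \<le> K"
      unfolding K_def using st B A r by (intro add_mono divide_right_mono mult_right_mono) auto
    finally show ?thesis .
  qed (use K in simp)
  have 1: "\<bar>integral {c..e1} (\<lambda>x. cos (\<phi> x))\<bar> \<le> K"
    using e by (intro away) (auto simp: e1_def split: if_splits)
  have 3: "\<bar>integral {e2..d} (\<lambda>x. cos (\<phi> x))\<bar> \<le> K"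
    using e by (intro away) (auto simp: e2_def split: if_splits)
  have "norm (integral {e1..e2} (\<lambda>x. cos (\<phi> x))) \<le> 1 * (e2 - e1)"
    using e by (intro integral_bound continuous_intros continuous_on_subset[OF c\<phi>]) auto
  then have 2: "\<bar>integral {e1..e2} (\<lambda>x. cos (\<phi> x))\<bar> \<le> 2 * r" by (simp add: e1_def e2_def)
  have "integral {c..d} (\<lambda>x. cos (\<phi> x)) = integral {c..e1} (\<lambda>x. cos (\<phi> x))
      + (integral {e1..e2} (\<lambda>x. cos (\<phi> x)) + integral {e2..d} (\<lambda>x. cos (\<phi> x)))"
    using e Henstock_Kurzweil_Integration.integral_combine[where a=c and c=e1 and b=d and f="\<lambda>x. cos (\<phi> x)"]
      Henstock_Kurzweil_Integration.integral_combine[where a=e1 and c=e2 and b=d and f="\<lambda>x. cos (\<phi> x)"] int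
    by simp
  then show ?thesis using 1 2 3 unfolding K_def[symmetric] by linarith
qed

text \<open>The point \<open>z\<close> is a zero of the increasing function \<open>u\<close>, or, if
  \<open>u\<close> keeps its sign, the endpoint where its modulus is smallest.\<close>

lemma linear_growth_from_point:
  fixes u u' :: "real \<Rightarrow> real"
  assumes cd: "c \<le> d" and cont: "continuous_on {c..d} u"
    and deriv: "\<And>x. x \<in> {c<..<d} \<Longrightarrow> (u has_real_derivative u' x) (at x)"
    and lower: "\<And>x. x \<in> {c<..<d} \<Longrightarrow> \<kappa> \<le> u' x" and \<kappa>: "0 \<le> \<kappa>"
  shows "\<exists>z\<in>{c..d}. \<forall>x\<in>{c..d}. \<kappa> * \<bar>x - z\<bar> \<le> \<bar>u x\<bar>"
proof -
  have grow: "\<kappa> * (y - x) \<le> u y - u x" if "c \<le> x" "x \<le> y" "y \<le> d" for x y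
  proof (cases "x = y")
    case False
    then have "x < y" using that by simp
    moreover have "continuous_on {x..y} u" using that by (intro continuous_on_subset[OF cont]) auto
    moreover have "u differentiable (at t)" if "x < t" "t < y" for t
      using that \<open>c \<le> x\<close> \<open>y \<le> d\<close> deriv[of t] by (auto simp: real_differentiable_def)
    ultimately obtain l t where t: "x < t" "t < y" "DERIV u t :> l" "u y - u x = (y - x) * l"
      using MVT[of x y u] by blast
    moreover have "l = u' t" using DERIV_unique[OF t(3) deriv[of t]] t that by auto
    ultimately show ?thesis using lower[of t] that by (simp add: mult.commute mult_left_mono)
  qed simp
  have base: ?thesis if z: "z \<in> {c..d}" and left: "\<And>x. c \<le> x \<Longrightarrow> x < z \<Longrightarrow> u z \<le> 0"
    and right: "\<And>x. z < x \<Longrightarrow> x \<le> d \<Longrightarrow> 0 \<le> u z" for z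
  proof (intro bexI[of _ z] ballI z)
    fix x assume x: "x \<in> {c..d}"
    consider "x < z" | "x = z" | "z < x" by linarith
    then show "\<kappa> * \<bar>x - z\<bar> \<le> \<bar>u x\<bar>"
    proof cases
      case 1
      then have "\<bar>x - z\<bar> = z - x" by simp
      then show ?thesis using grow[of x z] left[of x] 1 x z by simp
    next
      case 3
      then have "\<bar>x - z\<bar> = x - z" by simp
      then show ?thesis using grow[of z x] right[of x] 3 x z by simp
    qed simp
  qed
  consider "0 \<le> u c" | "u d \<le> 0" | "u c \<le> 0" "0 \<le> u d" by linarith
  then show ?thesis
  proof cases
    case 1 then show ?thesis using base[of c] cd by auto
  next
    case 2 then show ?thesis using base[of d] cd by auto
  next
    case 3
    obtain z where "c \<le> z" "z \<le> d" "u z = 0" using IVT'[of u c 0 d] 3 cd cont by blast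
    then show ?thesis using base[of z] by auto
  qed
qed

text \<open>Leads from the logarithms of two derivatives, whose difference has a known slope, back
  to the derivatives themselves.\<close>

lemma abs_ln_diff_le:
  fixes s t m :: real
  assumes "0 < m" "m \<le> s" "m \<le> t"
  shows "m * \<bar>ln s - ln t\<bar> \<le> \<bar>s - t\<bar>"
proof -
  have "m * (ln s - ln t) \<le> s - t" if "m \<le> t" "t \<le> s" for s t
  proof -
    have "m * (ln s - ln t) \<le> m * ((s - t) / t)"
      using that assms ln_diff_le[of s t] by (intro mult_left_mono) auto
    also have "\<dots> \<le> t * ((s - t) / t)" using that assms by (intro mult_right_mono) auto
    also have "\<dots> = s - t" using that assms by simp
    finally show ?thesis .
  qed
  from this[of t s] this[of s t] assms show ?thesis by (cases "t \<le> s") auto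
qed

subsection \<open>Energy of averaged waves\<close>

definition words :: "nat \<Rightarrow> bool list set" where
  "words n = {w. length w = n}"

lemma finite_words_n [simp]: "finite (words n)"
  unfolding words_def using finite_words[of n "\<lambda>_. True"] by simp

lemma card_words: "card (words n) = 2 ^ n"
  unfolding words_def using card_lists_length_eq[of "UNIV :: bool set" n] by simp

lemma words_Suc: "words (Suc n) = (#) False ` words n \<union> (#) True ` words n"
  by (auto simp: words_def length_Suc_conv image_iff)

lemma sum_words_Suc:
  fixes F :: "bool list \<Rightarrow> 'b::comm_monoid_add"
  shows "(\<Sum>w\<in>words (Suc n). F w) = (\<Sum>w\<in>words n. F (False # w)) + (\<Sum>w\<in>words n. F (True # w))"
  unfolding words_Suc by (subst sum.union_disjoint) (auto simp: sum.reindex)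

lemma cmod_sum_cis_sq:
  assumes "finite S"
  shows "(cmod (\<Sum>w\<in>S. cis (t w)))\<^sup>2 = (\<Sum>w\<in>S. \<Sum>w'\<in>S. cos (t w - t w'))"
proof -
  have "complex_of_real ((cmod (\<Sum>w\<in>S. cis (t w)))\<^sup>2) = (\<Sum>w\<in>S. cis (t w)) * cnj (\<Sum>w\<in>S. cis (t w))"
    by (rule complex_norm_square)
  also have "\<dots> = (\<Sum>w\<in>S. \<Sum>w'\<in>S. cis (t w - t w'))"
    by (simp add: sum_product cis_cnj cis_mult)
  finally have "Re (complex_of_real ((cmod (\<Sum>w\<in>S. cis (t w)))\<^sup>2)) = Re (\<Sum>w\<in>S. \<Sum>w'\<in>S. cis (t w - t w'))"
    by simp
  then show ?thesis by simp
qed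

lemma integral_uniform_partition:
  fixes q :: "real \<Rightarrow> real"
  assumes "q integrable_on {0..real n * h}" "0 \<le> h"
  shows "integral {0..real n * h} q = (\<Sum>j<n. integral {real j * h..real (Suc j) * h} q)"
  using assms(1)
proof (induction n)
  case (Suc n)
  have le: "real n * h \<le> real (Suc n) * h" "0 \<le> real n * h" using assms(2) by (auto intro: mult_right_mono)
  have "q integrable_on {0..real n * h}"
    by (rule integrable_on_subinterval[OF Suc.prems]) (use le in auto)
  then show ?case
    using Suc.IH le Suc.prems
      Henstock_Kurzweil_Integration.integral_combine[where a=0 and c="real n * h" and b="real (Suc n) * h" and f=q]
    by simp
qed simp

text \<open>The stationary phase bound with \<open>r = 10^-k\<close>, chosen to beat the \<open>16 * 5^k\<close> intervals on which
  it is applied.\<close>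

lemma oscillation_constant:
  fixes X d :: real
  assumes d: "0 < d" "d \<le> 1" and X: "2097152 ^ k \<le> X * d\<^sup>2" "0 < X"
  defines "A \<equiv> X * ((1/3) ^ (2 * k) * (d * (1 / (4 * 5 ^ k)) / 2))"
  shows "2 * (1/10) ^ k + 2 * (2 / (A * (1/10) ^ k) + 1 * X / (A * (1/10) ^ k)\<^sup>2) \<le> 162 * (1/10) ^ k"
proof -
  have Ar: "A * (1/10) ^ k = X * d / (8 * 450 ^ k)"
  proof -
    \<comment> \<open>The factors 9, 5 and 10 stem from the lower bound
      \<open>(1/3) ^ (2 * k)\<close> for the derivatives, the separation of the nonlinearities and
      the radius.\<close>
    have "(450::real) ^ k = (9 * 5 * 10) ^ k" by simp
    also have "\<dots> = 3 ^ (2 * k) * 5 ^ k * 10 ^ k" by (simp only: power_mult_distrib power_mult) simp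
    finally show ?thesis by (simp add: A_def power_divide)
  qed
  define T where "T = (2097152 ^ k :: real)"
  have T: "0 < T" "T \<le> X * d\<^sup>2" "T \<le> X * d"
  proof -
    have "X * d\<^sup>2 \<le> X * d" using X d by (intro mult_left_mono) (auto simp: power2_eq_square mult_left_le)
    with X(1) show "T \<le> X * d" unfolding T_def by (rule order_trans)
  qed (use X in \<open>auto simp: T_def\<close>)
  have Xd: "0 < X * d" "0 < X * d\<^sup>2" using d X by auto
  have "2 / (A * (1/10) ^ k) = 16 * 450 ^ k / (X * d)" unfolding Ar by simp
  also have "\<dots> \<le> 16 * 202500 ^ k / T"
    using T Xd by (intro frac_le mult_left_mono power_mono) auto
  finally have 1: "2 / (A * (1/10) ^ k) \<le> 16 * (202500 ^ k / T)" by simp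
  have "1 * X / (A * (1/10) ^ k)\<^sup>2 = 64 * (450 ^ k)\<^sup>2 / (X * d\<^sup>2)"
    unfolding Ar using X d by (simp add: power_divide power_mult_distrib power2_eq_square)
  also have "(450 ^ k)\<^sup>2 = (202500 ^ k :: real)" by (simp add: power2_eq_square flip: power_mult_distrib)
  also have "64 * 202500 ^ k / (X * d\<^sup>2) \<le> 64 * 202500 ^ k / T"
    using T Xd by (intro divide_left_mono) auto
  finally have 2: "1 * X / (A * (1/10) ^ k)\<^sup>2 \<le> 64 * (202500 ^ k / T)" by simp
  \<comment> \<open>Origin of \<open>2^21\<close>: it is the least power of 2 above
    \<open>10 * 202500\<close>.\<close>
  have "202500 ^ k / T = (202500 / 2097152) ^ k" unfolding T_def power_divide ..
  also have "\<dots> \<le> (1/10) ^ k" by (intro power_mono) auto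
  finally have 3: "202500 ^ k / T \<le> (1/10) ^ k" .
  have "2 * (1/10) ^ k + 2 * (2 / (A * (1/10) ^ k) + 1 * X / (A * (1/10) ^ k)\<^sup>2)
      \<le> 2 * (1/10) ^ k + 2 * (16 * (202500 ^ k / T) + 64 * (202500 ^ k / T))"
    by (intro add_left_mono mult_left_mono add_mono 1 2) simp
  also have "\<dots> = 2 * (1/10) ^ k + 160 * (202500 ^ k / T)" by simp
  also have "\<dots> \<le> 2 * (1/10) ^ k + 160 * (1/10) ^ k" by (intro add_left_mono mult_left_mono 3) simp
  also have "\<dots> = 162 * (1/10) ^ k" by simp
  finally show ?thesis .
qed

context small_delta
begin

lemma word_deriv_continuous: "continuous_on {0..1} (word_deriv w)"
proof (induction w)
  case Nil
  have "word_deriv [] = (\<lambda>x. 1)" by (simp add: fun_eq_iff)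
  then show ?case by simp
next
  case (Cons b w)
  have cb: "continuous_on {0..1} (branch b)"
    using branch_deriv by (meson DERIV_continuous_on has_field_derivative_at_within)
  have "continuous_on {0..1} (\<lambda>x. word_deriv w (branch b x))"
    by (rule continuous_on_compose2[OF Cons cb]) (use branch_in in blast)
  moreover have "continuous_on {0..1} p"
  proof -
    have "0 < 1 + a * min x (1 - x)" if "x \<in> {0..1}" for x
      using that a_pos by (intro add_pos_nonneg mult_nonneg_nonneg) (auto simp: min_def)
    then have "\<delta> * (1 + a * min x (1 - x)) \<noteq> 0" if "x \<in> {0..1}" for x
      using that \<delta>_pos by fastforce
    then show ?thesis unfolding p_def by (intro continuous_intros) auto
  qed
  ultimately have "continuous_on {0..1} (\<lambda>x. word_deriv w (branch b x) * (p x / 2))"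
    by (intro continuous_intros) auto
  then show ?case by simp
qed

text \<open>The logarithm of the quotient of the two derivatives has slope \<delta> times the
  difference of the nonlinearities. Over a length \<open>l / 4\<close> each nonlinearity moves by at
  most \<open>l / 4\<close>, so of the separation \<open>l\<close> at \<open>x0\<close> at least
  \<open>l / 2\<close> remains on the whole interval, and the phase derivative grows linearly away
  from one point.\<close>

lemma word_pair_oscillation:
  assumes uv: "u < v" and sub: "{u<..<v} \<subseteq> half b" "{u..v} \<subseteq> {0..1}" and vu: "v - u \<le> l / 4"
    and x0: "x0 \<in> {u<..<v}" and sep: "l < nonlin w x0 - nonlin w' x0"
    and len: "length w = n" "length w' = n" and \<xi>: "\<xi> \<noteq> 0" and r: "0 < r"
  defines "A \<equiv> \<bar>\<xi>\<bar> * ((1/3) ^ n * (\<delta> * l / 2))"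
  shows "\<bar>integral {u..v} (\<lambda>x. cos (\<xi> * (word_map w x - word_map w' x)))\<bar>
    \<le> 2 * r + 2 * (2 / (A * r) + (v - u) * \<bar>\<xi>\<bar> / (A * r)\<^sup>2)"
proof -
  have l: "0 < l" using uv vu by linarith
  have in01: "x \<in> {0..1}" if "x \<in> {u..v}" for x using sub that by blast
  \<comment> \<open>The word \<open>w'\<close> comes first because logarithmic derivatives are
    \<open>- \<delta> * nonlin\<close>; this makes the slope positive.\<close>
  define lr where "lr x = ln (word_deriv w' x) - ln (word_deriv w x)" for x
  have lr_deriv: "(lr has_real_derivative \<delta> * (nonlin w x - nonlin w' x)) (at x)" if "x \<in> {u<..<v}" for x
  proof -
    have h: "x \<in> half b" using that sub by blast
    have "(lr has_real_derivative
      1 / word_deriv w' x * (- \<delta> * nonlin w' x * word_deriv w' x)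
      - 1 / word_deriv w x * (- \<delta> * nonlin w x * word_deriv w x)) (at x)"
      unfolding lr_def
      by (intro DERIV_diff DERIV_chain2[OF DERIV_ln_divide] word_deriv_deriv[OF h]; intro word_deriv_pos half_subset[OF h])
    moreover have "1 / word_deriv w' x * (- \<delta> * nonlin w' x * word_deriv w' x)
      - 1 / word_deriv w x * (- \<delta> * nonlin w x * word_deriv w x) = \<delta> * (nonlin w x - nonlin w' x)"
      using word_deriv_pos[OF half_subset[OF h], of w] word_deriv_pos[OF half_subset[OF h], of w']
      by (simp add: field_simps)
    ultimately show ?thesis by simp
  qed
  have lr_lower: "\<delta> * l / 2 \<le> \<delta> * (nonlin w x - nonlin w' x)" if x: "x \<in> {u<..<v}" for x
  proof -
    have h: "x \<in> half b" "x0 \<in> half b" using x x0 sub by blast+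
    have "\<bar>x - x0\<bar> \<le> v - u" using x x0 by auto
    then have "\<bar>x - x0\<bar> \<le> l / 4" using vu by simp
    then have "l / 2 \<le> nonlin w x - nonlin w' x"
      using nonlin_lipschitz[OF h, of w] nonlin_lipschitz[OF h, of w'] sep by linarith
    then show ?thesis using \<delta>_pos by simp
  qed
  have lr_cont: "continuous_on {u..v} lr"
    unfolding lr_def
    by (intro continuous_intros continuous_on_subset[OF word_deriv_continuous sub(2)] ballI
        less_imp_neq[THEN not_sym] word_deriv_pos in01)
  have "\<exists>z\<in>{u..v}. \<forall>x\<in>{u..v}. (\<delta> * l / 2) * \<bar>x - z\<bar> \<le> \<bar>lr x\<bar>"
    by (rule linear_growth_from_point[OF _ lr_cont lr_deriv lr_lower]) (use uv l \<delta>_pos in auto)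
  then obtain z where z: "z \<in> {u..v}" "\<And>x. x \<in> {u..v} \<Longrightarrow> (\<delta> * l / 2) * \<bar>x - z\<bar> \<le> \<bar>lr x\<bar>"
    by blast
  show ?thesis
  proof (rule integral_cos_bound_stationary[OF z(1) _ r, where
        \<phi>'="\<lambda>x. \<xi> * (word_deriv w x - word_deriv w' x)" and
        \<phi>''="\<lambda>x. \<xi> * (- \<delta> * nonlin w x * word_deriv w x - - \<delta> * nonlin w' x * word_deriv w' x)"])
    show "0 < A" using \<xi> l \<delta>_pos by (simp add: A_def)
    show "((\<lambda>x. \<xi> * (word_map w x - word_map w' x)) has_real_derivative
        \<xi> * (word_deriv w x - word_deriv w' x)) (at x)" if "x \<in> {u..v}" for x
      by (intro DERIV_cmult DERIV_diff word_map_deriv in01 that)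
    show "continuous_on {u..v} (\<lambda>x. \<xi> * (word_deriv w x - word_deriv w' x))"
      by (intro continuous_intros continuous_on_subset[OF word_deriv_continuous sub(2)])
    show "((\<lambda>x. \<xi> * (word_deriv w x - word_deriv w' x)) has_real_derivative
        \<xi> * (- \<delta> * nonlin w x * word_deriv w x - - \<delta> * nonlin w' x * word_deriv w' x)) (at x)"
      if "x \<in> {u<..<v}" for x
      by (intro DERIV_cmult DERIV_diff word_deriv_deriv[of x b]) (use that sub in blast)+
    show "A * \<bar>x - z\<bar> \<le> \<bar>\<xi> * (word_deriv w x - word_deriv w' x)\<bar>" if x: "x \<in> {u..v}" for x
    proof -
      have "(1/3) ^ n * ((\<delta> * l / 2) * \<bar>x - z\<bar>) \<le> (1/3) ^ n * \<bar>lr x\<bar>"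
        using z(2)[OF x] by (intro mult_left_mono) auto
      also have "\<dots> \<le> \<bar>word_deriv w' x - word_deriv w x\<bar>"
        unfolding lr_def using word_deriv_bounds[OF in01[OF x], of w] word_deriv_bounds[OF in01[OF x], of w'] len
        by (intro abs_ln_diff_le) auto
      finally have "\<bar>\<xi>\<bar> * ((1/3) ^ n * ((\<delta> * l / 2) * \<bar>x - z\<bar>)) \<le> \<bar>\<xi>\<bar> * \<bar>word_deriv w' x - word_deriv w x\<bar>"
        by (intro mult_left_mono) auto
      then show ?thesis by (simp add: A_def abs_mult mult.assoc abs_minus_commute)
    qed
    show "\<bar>\<xi> * (- \<delta> * nonlin w x * word_deriv w x - - \<delta> * nonlin w' x * word_deriv w' x)\<bar> \<le> \<bar>\<xi>\<bar>"
      if x: "x \<in> {u<..<v}" for x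
    proof -
      have x': "x \<in> {0..1}" using x in01 by auto
      have b: "\<bar>\<delta> * nonlin w x * word_deriv w x\<bar> \<le> 1/2" for w
      proof -
        have "\<bar>\<delta> * nonlin w x * word_deriv w x\<bar> \<le> (1/100 * 3) * 1"
          unfolding abs_mult using nonlin_bound[OF x', of w] word_deriv_le_1[OF x', of w]
            word_deriv_pos[OF x', of w] \<delta>_pos \<delta>_le
          by (intro mult_mono) auto
        then show ?thesis by simp
      qed
      have "\<bar>- \<delta> * nonlin w x * word_deriv w x - - \<delta> * nonlin w' x * word_deriv w' x\<bar> \<le> 1"
        using abs_triangle_ineq4[of "- \<delta> * nonlin w x * word_deriv w x" "- \<delta> * nonlin w' x * word_deriv w' x"]
          b[of w] b[of w'] by simp
      then have "\<bar>\<xi>\<bar> * \<bar>- \<delta> * nonlin w x * word_deriv w x - - \<delta> * nonlin w' x * word_deriv w' x\<bar> \<le> \<bar>\<xi>\<bar> * 1"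
        by (intro mult_left_mono) auto
      then show ?thesis by (simp add: abs_mult)
    qed
  qed simp
qed

lemma word_map_continuous: "continuous_on {0..1} (word_map w)"
  using word_map_deriv by (meson DERIV_continuous_on has_field_derivative_at_within)

definition wave :: "nat \<Rightarrow> real \<Rightarrow> real \<Rightarrow> complex" where
  "wave n \<xi> x = (\<Sum>w\<in>words n. cis (\<xi> * word_map w x)) / 2 ^ n"

lemma wave_norm_sq:
  "(cmod (wave n \<xi> x))\<^sup>2 = (\<Sum>w\<in>words n. \<Sum>w'\<in>words n. cos (\<xi> * (word_map w x - word_map w' x))) / 4 ^ n"
proof -
  have "(cmod (wave n \<xi> x))\<^sup>2 = (cmod (\<Sum>w\<in>words n. cis (\<xi> * word_map w x)))\<^sup>2 / (2 ^ n)\<^sup>2"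
    by (simp add: wave_def norm_divide norm_power power_divide)
  also have "(2 ^ n)\<^sup>2 = (4 ^ n :: real)" by (simp add: power2_eq_square flip: power_mult_distrib)
  finally show ?thesis by (simp add: cmod_sum_cis_sq right_diff_distrib)
qed

lemma wave_continuous: "continuous_on {0..1} (wave n \<xi>)"
proof -
  have "continuous_on {0..1} (\<lambda>x. cis (\<xi> * word_map w x))" for w
    unfolding cis_conv_exp by (intro continuous_intros word_map_continuous)
  then show ?thesis unfolding wave_def by (intro continuous_on_divide continuous_on_sum continuous_on_const) auto
qed

text \<open>The squared modulus expands into pairs of words. Pairs whose nonlinearities at the
  midpoint differ by at most \<open>l\<close> are a share of at most \<open>2^-k\<close> and are
  bounded by the length of the interval; every other pair oscillates and is bounded by
  \<open>R\<close>.\<close>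

lemma wave_energy_interval:
  assumes uv: "u < v" and sub: "{u<..<v} \<subseteq> half b" "{u..v} \<subseteq> {0..1}" and vu: "v - u \<le> l / 4"
    and l: "5 ^ k * l \<le> 1/4" and \<xi>: "\<xi> \<noteq> 0"
    and R: "\<And>w w' x0. w \<in> words (2 * k) \<Longrightarrow> w' \<in> words (2 * k) \<Longrightarrow> x0 \<in> {u<..<v} \<Longrightarrow>
      l < nonlin w x0 - nonlin w' x0 \<Longrightarrow>
      \<bar>integral {u..v} (\<lambda>x. cos (\<xi> * (word_map w x - word_map w' x)))\<bar> \<le> R" and R0: "0 \<le> R"
  shows "integral {u..v} (\<lambda>x. (cmod (wave (2 * k) \<xi> x))\<^sup>2) \<le> (v - u) / 2 ^ k + R"
proof -
  define x0 where "x0 = (u + v) / 2"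
  have x0: "x0 \<in> {u<..<v}" using uv by (auto simp: x0_def)
  then have h0: "x0 \<in> half b" using sub by blast
  define J where "J w w' = integral {u..v} (\<lambda>x. cos (\<xi> * (word_map w x - word_map w' x)))" for w w'
  have c: "continuous_on {u..v} (word_map w)" for w by (rule continuous_on_subset[OF word_map_continuous sub(2)])
  have int: "(\<lambda>x. cos (\<xi> * (word_map w x - word_map w' x))) integrable_on {u..v}" for w w'
    by (intro integrable_continuous_real continuous_intros c)
  have "integral {u..v} (\<lambda>x. (cmod (wave (2 * k) \<xi> x))\<^sup>2) = (\<Sum>w\<in>words (2 * k). \<Sum>w'\<in>words (2 * k). J w w') / 4 ^ (2 * k)"
    unfolding wave_norm_sq J_def
    by (simp add: integral_sum int integrable_sum)
  also have "\<dots> \<le> (\<Sum>w\<in>words (2 * k). 2 ^ k * (v - u) + 2 ^ (2 * k) * R) / 4 ^ (2 * k)"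
  proof (intro divide_right_mono sum_mono)
    fix w assume w: "w \<in> words (2 * k)"
    define N where "N = {w' \<in> words (2 * k). \<bar>nonlin w' x0 - nonlin w x0\<bar> \<le> l}"
    have "card N \<le> 2 ^ k"
      unfolding N_def words_def using card_nonlin_window[OF h0 _ l, of "nonlin w x0"] uv vu by simp
    have near: "J w w' \<le> v - u" for w'
    proof -
      have "norm (J w w') \<le> 1 * (v - u)"
        unfolding J_def using uv by (intro integral_bound continuous_intros c) auto
      then show ?thesis by simp
    qed
    have far: "J w w' \<le> R" if w': "w' \<in> words (2 * k) - N" for w'
    proof -
      from w' consider "l < nonlin w x0 - nonlin w' x0" | "l < nonlin w' x0 - nonlin w x0"
        unfolding N_def by force
      then have "\<bar>J w w'\<bar> \<le> R"
      proof cases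
        case 1 then show ?thesis unfolding J_def using R[of w w' x0] w w' x0 by auto
      next
        case 2
        \<comment> \<open>Cosine is even, so the pair can be swapped to meet the one-sided
          hypothesis \<open>R\<close>.\<close>
        have "J w w' = J w' w" unfolding J_def
          by (intro integral_cong) (metis cos_minus minus_diff_eq mult_minus_right)
        then show ?thesis using 2 R[of w' w x0] w w' x0 unfolding J_def by auto
      qed
      then show ?thesis by simp
    qed
    have "(\<Sum>w'\<in>words (2 * k). J w w') = (\<Sum>w'\<in>words (2 * k) - N. J w w') + (\<Sum>w'\<in>N. J w w')"
      by (rule sum.subset_diff) (auto simp: N_def)
    also have "(\<Sum>w'\<in>words (2 * k) - N. J w w') \<le> card (words (2 * k) - N) * R"
      using sum_bounded_above[of "words (2 * k) - N" "J w" R] far by simp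
    also have "card (words (2 * k) - N) * R \<le> 2 ^ (2 * k) * R"
      using card_mono[of "words (2 * k)" "words (2 * k) - N"] R0
      by (intro mult_right_mono) (auto simp: card_words simp flip: of_nat_power)
    also have "(\<Sum>w'\<in>N. J w w') \<le> card N * (v - u)"
      using sum_bounded_above[of N "J w" "v - u"] near by simp
    also have "card N * (v - u) \<le> 2 ^ k * (v - u)"
      using \<open>card N \<le> 2 ^ k\<close> uv by (intro mult_right_mono) (auto simp flip: of_nat_power)
    finally show "(\<Sum>w'\<in>words (2 * k). J w w') \<le> 2 ^ k * (v - u) + 2 ^ (2 * k) * R" by linarith
  qed simp
  also have "\<dots> = (v - u) / 2 ^ k + R"
  proof -
    have "(4::real) ^ (2 * k) = 2 ^ (2 * k) * 2 ^ (2 * k)" "(2::real) ^ (2 * k) = 2 ^ k * 2 ^ k"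
      by (simp_all add: mult_2 power_add flip: power_mult_distrib)
    then show ?thesis by (simp add: card_words field_simps)
  qed
  finally show ?thesis .
qed

lemma wave_energy:
  assumes \<xi>: "2097152 ^ k \<le> \<bar>\<xi>\<bar> * \<delta>\<^sup>2"
  shows "integral {0..1} (\<lambda>x. (cmod (wave (2 * k) \<xi> x))\<^sup>2) \<le> 2593 / 2 ^ k"
proof -
  \<comment> \<open>The length \<open>h\<close> is a quarter of the separation
    \<open>1 / (4 * 5 ^ k)\<close>, the largest that \<open>word_pair_oscillation\<close> admits.
    The even number of intervals makes 1/2 a division point, so that each interval lies in one
    half.\<close>
  define M :: nat where "M = 8 * 5 ^ k"
  define h :: real where "h = 1 / (16 * 5 ^ k)"
  have h: "0 < h" "real (2 * M) * h = 1" "real M * h = 1/2" by (auto simp: h_def M_def)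
  have "1 \<le> (5::real) ^ k" by simp
  then have "1 \<le> 16 * (5::real) ^ k" by linarith
  then have h1: "h \<le> 1" by (simp add: h_def)
  have "0 < (2097152::real) ^ k" by simp
  then have "0 < \<bar>\<xi>\<bar> * \<delta>\<^sup>2" using assms by (rule less_le_trans)
  then have \<xi>0: "\<xi> \<noteq> 0" by auto
  let ?q = "\<lambda>x. (cmod (wave (2 * k) \<xi> x))\<^sup>2"
  have int: "?q integrable_on {0..1}"
    by (intro integrable_continuous_real continuous_intros wave_continuous)
  have piece: "integral {real j * h..real (Suc j) * h} ?q \<le> h / 2 ^ k + 162 * (1/10) ^ k" if j: "j < 2 * M" for j
  proof -
    define b where "b \<longleftrightarrow> M \<le> j"
    let ?u = "real j * h" and ?v = "real (Suc j) * h"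
    have "?v \<le> real (2 * M) * h" using j h by (intro mult_right_mono) auto
    then have v1: "?v \<le> 1" unfolding h(2) .
    have sub: "{?u<..<?v} \<subseteq> half b"
    proof (cases b)
      case True
      then have "real M * h \<le> ?u" using h by (intro mult_right_mono) (auto simp: b_def)
      then show ?thesis using v1 h True by (auto simp: half_def)
    next
      case False
      then have "?v \<le> real M * h" using h by (intro mult_right_mono) (auto simp: b_def)
      moreover have "0 \<le> ?u" using h by simp
      ultimately show ?thesis using h(3) False by (auto simp: half_def)
    qed
    have sub1: "{?u..?v} \<subseteq> {0..1}" using h v1 by (auto intro: order_trans[of _ "real j * h"])
    have vu: "?v - ?u = h" by (simp add: algebra_simps)
    have uv: "?u < ?v" using vu h by linarith
    have gap: "?v - ?u \<le> 1 / (4 * 5 ^ k) / 4" unfolding vu by (simp add: h_def)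
    have "integral {?u..?v} ?q \<le> (?v - ?u) / 2 ^ k + 162 * (1/10) ^ k"
    proof (rule wave_energy_interval[OF uv sub sub1 gap])
      show "5 ^ k * (1 / (4 * 5 ^ k)) \<le> 1 / (4::real)" by simp
      show "\<xi> \<noteq> 0" by (rule \<xi>0)
      fix w w' x0
      assume w: "w \<in> words (2 * k)" "w' \<in> words (2 * k)" and x0: "x0 \<in> {?u<..<?v}"
        and sep: "1 / (4 * 5 ^ k) < nonlin w x0 - nonlin w' x0"
      let ?A = "\<bar>\<xi>\<bar> * ((1/3) ^ (2 * k) * (\<delta> * (1 / (4 * 5 ^ k)) / 2))"
      have "\<bar>integral {?u..?v} (\<lambda>x. cos (\<xi> * (word_map w x - word_map w' x)))\<bar>
         \<le> 2 * (1/10) ^ k + 2 * (2 / (?A * (1/10) ^ k) + (?v - ?u) * \<bar>\<xi>\<bar> / (?A * (1/10) ^ k)\<^sup>2)"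
        by (rule word_pair_oscillation[OF uv sub sub1 gap x0 sep])
           (use w \<xi>0 in \<open>auto simp: words_def\<close>)
      also have "\<dots> \<le> 2 * (1/10) ^ k + 2 * (2 / (?A * (1/10) ^ k) + 1 * \<bar>\<xi>\<bar> / (?A * (1/10) ^ k)\<^sup>2)"
        unfolding vu using h h1 by (intro add_left_mono mult_left_mono divide_right_mono mult_right_mono) auto
      also have "\<dots> \<le> 162 * (1/10) ^ k"
        by (rule oscillation_constant[OF \<delta>_pos _ assms]) (use \<delta>_le \<xi>0 in auto)
      finally show "\<bar>integral {?u..?v} (\<lambda>x. cos (\<xi> * (word_map w x - word_map w' x)))\<bar> \<le> 162 * (1/10) ^ k" .
    qed simp
    then show ?thesis unfolding vu .
  qed
  have "integral {0..1} ?q = (\<Sum>j<2 * M. integral {real j * h..real (Suc j) * h} ?q)"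
    using integral_uniform_partition[of ?q "2 * M" h] int h by (simp only: h(2))
  also have "\<dots> \<le> real (2 * M) * (h / 2 ^ k + 162 * (1/10) ^ k)"
    using sum_bounded_above[of "{..<2 * M}" "\<lambda>j. integral {real j * h..real (Suc j) * h} ?q"] piece by simp
  \<comment> \<open>The oscillating pairs contribute
    \<open>16 * 5^k * 162 * 10^-k = 2592 * 2^-k\<close>.\<close>
  also have "\<dots> = 1 / 2 ^ k + 2592 * (5 ^ k * (1/10) ^ k)"
    using h(2) by (simp add: distrib_left M_def)
  also have "5 ^ k * (1/10) ^ k = ((1/2) ^ k :: real)"
    unfolding power_mult_distrib[symmetric] by simp
  finally show ?thesis by (simp add: power_divide)
qed

end

subsection \<open>Transfer to the invariant measure\<close>

text \<open>Invariance of Lebesgue measure under doubling, written with the two inverse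
  branches.\<close>

lemma integral_split_halves:
  fixes g :: "real \<Rightarrow> 'a::euclidean_space"
  assumes "continuous_on {0..1} g"
  shows "integral {0..1} g = integral {0..1} (\<lambda>x. (1/2) *\<^sub>R (g (x / 2) + g ((x + 1) / 2)))"
proof -
  have "((\<lambda>x. (1/2) *\<^sub>R g (x / 2)) has_integral integral {0 / 2..1 / 2} g) {0..1}"
    by (rule has_integral_substitution[OF _ _ _ assms]) (auto intro!: derivative_eq_intros)
  moreover have "((\<lambda>x. (1/2) *\<^sub>R g ((x + 1) / 2)) has_integral integral {(0 + 1) / 2..(1 + 1) / 2} g) {0..1}"
    by (rule has_integral_substitution[OF _ _ _ assms]) (auto intro!: derivative_eq_intros)
  ultimately have "((\<lambda>x. (1/2) *\<^sub>R g (x / 2) + (1/2) *\<^sub>R g ((x + 1) / 2)) has_integral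
      (integral {0..1/2} g + integral {1/2..1} g)) {0..1}"
    by (simp add: has_integral_add)
  moreover have "integral {0..1/2} g + integral {1/2..1} g = integral {0..1} g"
    by (intro Henstock_Kurzweil_Integration.integral_combine integrable_continuous_real assms) auto
  ultimately show ?thesis by (simp add: integral_unique scaleR_add_right)
qed

text \<open>The variance of \<open>v\<close> is nonnegative.\<close>

lemma integral_power2_le:
  fixes v :: "real \<Rightarrow> real"
  assumes "continuous_on {0..1} v"
  shows "(integral {0..1} v)\<^sup>2 \<le> integral {0..1} (\<lambda>x. (v x)\<^sup>2)"
proof -
  define c where "c = integral {0..1} v"
  have v: "(v has_integral c) {0..1}"
    unfolding c_def by (intro integrable_integral integrable_continuous_real assms)
  have v2: "((\<lambda>x. (v x)\<^sup>2) has_integral integral {0..1} (\<lambda>x. (v x)\<^sup>2)) {0..1}"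
    by (intro integrable_integral integrable_continuous_real continuous_intros assms)
  have "((\<lambda>x. c\<^sup>2) has_integral c\<^sup>2) {0..1::real}"
    using has_integral_const_real[of "c\<^sup>2" 0 "1::real"] by simp
  then have "((\<lambda>x. (v x)\<^sup>2 - 2 * c * v x + c\<^sup>2) has_integral
      (integral {0..1} (\<lambda>x. (v x)\<^sup>2) - 2 * c * c + c\<^sup>2)) {0..1}"
    by (intro has_integral_add has_integral_diff v2 has_integral_mult_right v)
  then have "0 \<le> integral {0..1} (\<lambda>x. (v x)\<^sup>2) - 2 * c * c + c\<^sup>2"
    by (rule has_integral_nonneg) (smt (verit) power2_diff zero_le_power2 mult.commute mult.assoc)
  then show ?thesis by (simp add: c_def power2_eq_square)
qed

text \<open>An identity on the circle leaves an unknown integer at every point of the line; by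
  continuity a single integer remains to be determined.\<close>

lemma continuous_Ints_constant:
  fixes g :: "real \<Rightarrow> real"
  assumes "continuous_on {0..1} g" "\<And>x. x \<in> {0..1} \<Longrightarrow> g x \<in> \<int>" "x \<in> {0..1}" "y \<in> {0..1}"
  shows "g x = g y"
proof -
  have "g constant_on {0..1}"
  proof (rule continuous_discrete_range_constant[OF _ assms(1)])
    fix x :: real assume x: "x \<in> {0..1}"
    have "1 \<le> norm (g y - g x)" if "y \<in> {0..1}" "g y \<noteq> g x" for y
      using that assms(2) x Ints_nonzero_abs_ge1[of "g y - g x"] by (auto intro: Ints_diff)
    then show "\<exists>e>0. \<forall>y. y \<in> {0..1} \<and> g y \<noteq> g x \<longrightarrow> e \<le> norm (g y - g x)"
      by (intro exI[of _ 1]) auto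
  qed simp
  then show ?thesis using assms(3,4) by (auto simp: constant_on_def)
qed

lemma cis_lipschitz: "cmod (cis s - cis t) \<le> \<bar>s - t\<bar>"
  using dist_circ_le[of "s / (2 * pi)" "t / (2 * pi)"]
  by (simp add: circ_def dist_norm flip: diff_divide_distrib)

context small_delta
begin

lemma wave_0: "wave 0 \<xi> x = cis (\<xi> * x)"
  by (simp add: wave_def words_def)

lemma wave_Suc: "wave (Suc n) \<xi> x = (1/2) *\<^sub>R (wave n \<xi> (branch False x) + wave n \<xi> (branch True x))"
  by (simp add: wave_def sum_words_Suc scaleR_conv_of_real field_simps)

lemma word_map_lipschitz:
  "x \<in> {0..1} \<Longrightarrow> y \<in> {0..1} \<Longrightarrow> \<bar>word_map w x - word_map w y\<bar> \<le> \<bar>x - y\<bar>"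
proof (induction w arbitrary: x y)
  case (Cons b w)
  have "\<bar>word_map (b # w) x - word_map (b # w) y\<bar> \<le> \<bar>branch b x - branch b y\<bar>"
    using Cons.IH[OF branch_in[OF Cons.prems(1)] branch_in[OF Cons.prems(2)]] by simp
  also have "\<dots> \<le> (1 + \<delta>) / 2 * \<bar>x - y\<bar>" by (rule branch_lipschitz[OF Cons.prems])
  also have "\<dots> \<le> 1 * \<bar>x - y\<bar>" using \<delta>_le by (intro mult_right_mono) auto
  finally show ?case by simp
qed simp

lemma wave_norm_le_1: "cmod (wave n \<xi> x) \<le> 1"
proof -
  have "cmod (\<Sum>w\<in>words n. cis (\<xi> * word_map w x)) \<le> (\<Sum>w\<in>words n. 1)"
    by (rule sum_norm_le) simp
  then show ?thesis by (simp add: wave_def norm_divide norm_power card_words)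
qed

lemma wave_lipschitz:
  assumes "x \<in> {0..1}" "y \<in> {0..1}"
  shows "cmod (wave n \<xi> x - wave n \<xi> y) \<le> \<bar>\<xi>\<bar> * \<bar>x - y\<bar>"
proof -
  have "cmod (cis (\<xi> * word_map w x) - cis (\<xi> * word_map w y)) \<le> \<bar>\<xi>\<bar> * \<bar>x - y\<bar>" for w
  proof -
    have "cmod (cis (\<xi> * word_map w x) - cis (\<xi> * word_map w y)) \<le> \<bar>\<xi> * word_map w x - \<xi> * word_map w y\<bar>"
      by (rule cis_lipschitz)
    also have "\<dots> = \<bar>\<xi>\<bar> * \<bar>word_map w x - word_map w y\<bar>" by (simp add: abs_mult flip: right_diff_distrib)
    also have "\<dots> \<le> \<bar>\<xi>\<bar> * \<bar>x - y\<bar>" by (intro mult_left_mono word_map_lipschitz assms) auto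
    finally show ?thesis .
  qed
  then have "cmod (\<Sum>w\<in>words n. cis (\<xi> * word_map w x) - cis (\<xi> * word_map w y)) \<le> (\<Sum>w\<in>words n. \<bar>\<xi>\<bar> * \<bar>x - y\<bar>)"
    by (intro sum_norm_le)
  then have "cmod (\<Sum>w\<in>words n. cis (\<xi> * word_map w x) - cis (\<xi> * word_map w y)) / 2 ^ n \<le> \<bar>\<xi>\<bar> * \<bar>x - y\<bar>"
    by (simp add: card_words divide_le_eq mult.commute)
  moreover have "wave n \<xi> x - wave n \<xi> y = (\<Sum>w\<in>words n. cis (\<xi> * word_map w x) - cis (\<xi> * word_map w y)) / 2 ^ n"
    by (simp add: wave_def sum_subtractf diff_divide_distrib)
  ultimately show ?thesis by (simp add: norm_divide norm_power)
qed

lemma wave_sq_lipschitz: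
  assumes "x \<in> {0..1}" "y \<in> {0..1}"
  shows "\<bar>(cmod (wave n \<xi> x))\<^sup>2 - (cmod (wave n \<xi> y))\<^sup>2\<bar> \<le> 2 * \<bar>\<xi>\<bar> * \<bar>x - y\<bar>"
proof -
  let ?s = "cmod (wave n \<xi> x)" and ?t = "cmod (wave n \<xi> y)"
  have "\<bar>?s\<^sup>2 - ?t\<^sup>2\<bar> = \<bar>?s - ?t\<bar> * (?s + ?t)"
    by (simp add: power2_eq_square square_diff_square_factored abs_mult)
  also have "\<dots> \<le> (\<bar>\<xi>\<bar> * \<bar>x - y\<bar>) * 2"
    using wave_norm_le_1[of n \<xi> x] wave_norm_le_1[of n \<xi> y]
    by (intro mult_mono order_trans[OF norm_triangle_ineq3 wave_lipschitz[OF assms]]) auto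
  finally show ?thesis by (simp add: mult_ac)
qed

text \<open>With weights \<open>p x / 2\<close> the average over the branches preserves the Lebesgue
  integral, by substitution on each branch. The equal weights 1/2 exceed these by a factor of at
  most \<open>exp (\<delta> / 2)\<close>, and \<open>q\<close> is nonnegative.\<close>

lemma integral_branch_le:
  fixes q :: "real \<Rightarrow> real"
  assumes q: "continuous_on {0..1} q" "\<And>x. x \<in> {0..1} \<Longrightarrow> 0 \<le> q x"
  shows "integral {0..1} (\<lambda>x. (q (branch False x) + q (branch True x)) / 2) \<le> exp (\<delta> / 2) * integral {0..1} q"
proof -
  have cb: "continuous_on {0..1} (branch b)" for b
    using branch_deriv by (meson DERIV_continuous_on has_field_derivative_at_within)
  have cq: "continuous_on {0..1} (\<lambda>x. q (branch b x))" for b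
    by (rule continuous_on_compose2[OF q(1) cb]) (use branch_in in blast)
  have sub: "((\<lambda>x. (p x / 2) *\<^sub>R q (branch b x)) has_integral integral {branch b 0..branch b 1} q) {0..1}" for b
  proof (rule has_integral_substitution[where c=0 and d=1])
    show "branch b 0 \<le> branch b 1" by (simp add: branch_def G_0 G_1)
    show "branch b ` {0..1} \<subseteq> {0..1}" using branch_in by blast
  qed (use q branch_deriv in \<open>auto intro: has_field_derivative_at_within\<close>)
  have "((\<lambda>x. (p x / 2) * q (branch False x) + (p x / 2) * q (branch True x)) has_integral
      (integral {0..1/2} q + integral {1/2..1} q)) {0..1}"
    using has_integral_add[OF sub[of False] sub[of True]] by (simp add: branch_def G_0 G_1)
  moreover have "integral {0..1/2} q + integral {1/2..1} q = integral {0..1} q"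
    by (intro Henstock_Kurzweil_Integration.integral_combine integrable_continuous_real q) auto
  ultimately have R: "((\<lambda>x. exp (\<delta> / 2) * ((p x / 2) * q (branch False x) + (p x / 2) * q (branch True x))) has_integral
      exp (\<delta> / 2) * integral {0..1} q) {0..1}"
    by (intro has_integral_mult_right) simp
  have L: "((\<lambda>x. (q (branch False x) + q (branch True x)) / 2) has_integral
      integral {0..1} (\<lambda>x. (q (branch False x) + q (branch True x)) / 2)) {0..1}"
    by (intro integrable_integral integrable_continuous_real continuous_intros cq) auto
  show ?thesis
  proof (rule has_integral_le[OF L R])
    fix x :: real assume x: "x \<in> {0..1}"
    let ?Q = "q (branch False x) + q (branch True x)"
    have Q: "0 \<le> ?Q" using q(2) branch_in[OF x] by (simp add: add_nonneg_nonneg)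
    have "exp (\<delta> / 2) * exp (- \<delta> / 2) = 1" by (simp flip: exp_add)
    then have "1 \<le> exp (\<delta> / 2) * p x"
      using mult_left_mono[OF p_bounds(1)[OF x], of "exp (\<delta> / 2)"] by simp
    then have "1 * (?Q / 2) \<le> (exp (\<delta> / 2) * p x) * (?Q / 2)" using Q by (intro mult_right_mono) auto
    then show "?Q / 2 \<le> exp (\<delta> / 2) * ((p x / 2) * q (branch False x) + (p x / 2) * q (branch True x))"
      by (simp add: algebra_simps)
  qed
qed

end

text \<open>The form in which the conjugacy enters the estimates: the two functional equations make
  the image of Lebesgue measure under \<psi> stationary for a random choice of branch with
  probabilities 1/2.\<close>

locale conjugated = small_delta +
  fixes \<psi> :: "real \<Rightarrow> real"
  assumes cont: "continuous_on {0..1} \<psi>"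
    and range: "\<And>x. x \<in> {0..1} \<Longrightarrow> \<psi> x \<in> {0..1}"
    and left: "\<And>x. x \<in> {0..1} \<Longrightarrow> \<psi> (x / 2) = branch False (\<psi> x)"
    and right: "\<And>x. x \<in> {0..1} \<Longrightarrow> \<psi> ((x + 1) / 2) = branch True (\<psi> x)"
begin

lemma integral_transfer:
  fixes h :: "real \<Rightarrow> 'a::euclidean_space"
  assumes "continuous_on {0..1} h"
  shows "integral {0..1} (\<lambda>x. h (\<psi> x))
    = integral {0..1} (\<lambda>x. (1/2) *\<^sub>R (h (branch False (\<psi> x)) + h (branch True (\<psi> x))))"
proof -
  have "continuous_on {0..1} (\<lambda>x. h (\<psi> x))"
    by (rule continuous_on_compose2[OF assms cont]) (use range in blast)
  note integral_split_halves[OF this]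
  also have "integral {0..1} (\<lambda>x. (1/2) *\<^sub>R (h (\<psi> (x / 2)) + h (\<psi> ((x + 1) / 2))))
      = integral {0..1} (\<lambda>x. (1/2) *\<^sub>R (h (branch False (\<psi> x)) + h (branch True (\<psi> x))))"
    by (rule integral_cong) (simp only: left right)
  finally show ?thesis .
qed

lemma integral_wave: "integral {0..1} (\<lambda>x. wave n \<xi> (\<psi> x)) = integral {0..1} (\<lambda>x. cis (\<xi> * \<psi> x))"
proof (induction n)
  case (Suc n)
  show ?case unfolding Suc[symmetric] wave_Suc by (rule integral_transfer[OF wave_continuous, symmetric])
qed (simp add: wave_0)

text \<open>This replaces a lower bound on the dimension of the image of Lebesgue measure under \<open>\<psi>\<close>.\<close>

lemma integral_le_lipschitz:
  fixes q :: "real \<Rightarrow> real"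
  assumes "continuous_on {0..1} q" "\<And>x. x \<in> {0..1} \<Longrightarrow> 0 \<le> q x"
    and "\<And>x y. x \<in> {0..1} \<Longrightarrow> y \<in> {0..1} \<Longrightarrow> \<bar>q x - q y\<bar> \<le> L * \<bar>x - y\<bar>" and "0 \<le> L"
  shows "integral {0..1} (\<lambda>x. q (\<psi> x)) \<le> exp (\<delta> / 2) ^ m * integral {0..1} q + ((1 + \<delta>) / 2) ^ m * L"
  using assms
proof (induction m arbitrary: q L)
  case 0
  \<comment> \<open>On an interval of length 1 a function with Lipschitz constant \<open>L\<close>
    exceeds its mean by at most \<open>L\<close>.\<close>
  have q: "q y \<le> integral {0..1} q + L" if y: "y \<in> {0..1}" for y
  proof -
    have "integral {0..1::real} (\<lambda>t. q y - L) \<le> integral {0..1} q"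
    proof (rule Henstock_Kurzweil_Integration.integral_le)
      fix t :: real assume t: "t \<in> {0..1}"
      then have "L * \<bar>y - t\<bar> \<le> L * 1" using y 0(4) by (intro mult_left_mono) auto
      then show "q y - L \<le> q t" using 0(3)[OF y t] by simp
    qed (auto intro: integrable_continuous_real 0(1))
    then show ?thesis by simp
  qed
  have "integral {0..1} (\<lambda>x. q (\<psi> x)) \<le> integral {0..1::real} (\<lambda>x. integral {0..1} q + L)"
    by (intro Henstock_Kurzweil_Integration.integral_le integrable_continuous_real continuous_on_compose2[OF 0(1) cont] q range continuous_intros)
       (use range in auto)
  then show ?case by simp
next
  case (Suc m)
  \<comment> \<open>One averaging leaves the integral along \<psi> unchanged, shrinks the Lipschitz
    constant by \<open>(1 + \<delta>) / 2\<close> and enlarges the Lebesgue integral by at most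
    \<open>exp (\<delta> / 2)\<close>.\<close>
  define Q where "Q x = (q (branch False x) + q (branch True x)) / 2" for x
  have cb: "continuous_on {0..1} (branch b)" for b
    using branch_deriv by (meson DERIV_continuous_on has_field_derivative_at_within)
  have Qc: "continuous_on {0..1} Q" unfolding Q_def
    by (intro continuous_intros continuous_on_compose2[OF Suc.prems(1) cb]) (use branch_in in auto)
  have Q0: "0 \<le> Q x" if "x \<in> {0..1}" for x
    using Suc.prems(2)[OF branch_in[OF that]] by (simp add: Q_def add_nonneg_nonneg)
  have QL: "\<bar>Q x - Q y\<bar> \<le> (L * ((1 + \<delta>) / 2)) * \<bar>x - y\<bar>" if xy: "x \<in> {0..1}" "y \<in> {0..1}" for x y
  proof -
    have b: "\<bar>q (branch b x) - q (branch b y)\<bar> \<le> L * ((1 + \<delta>) / 2 * \<bar>x - y\<bar>)" for b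
      using Suc.prems(3)[OF branch_in[OF xy(1), of b] branch_in[OF xy(2), of b]]
        mult_left_mono[OF branch_lipschitz[OF xy, of b] Suc.prems(4)] by simp
    have "Q x - Q y = (q (branch False x) - q (branch False y)) / 2 + (q (branch True x) - q (branch True y)) / 2"
      by (simp add: Q_def field_simps)
    then have "\<bar>Q x - Q y\<bar> \<le> \<bar>(q (branch False x) - q (branch False y)) / 2\<bar> + \<bar>(q (branch True x) - q (branch True y)) / 2\<bar>"
      using abs_triangle_ineq by metis
    also have "\<dots> = \<bar>q (branch False x) - q (branch False y)\<bar> / 2 + \<bar>q (branch True x) - q (branch True y)\<bar> / 2"
      by simp
    also have "\<dots> \<le> L * ((1 + \<delta>) / 2 * \<bar>x - y\<bar>) / 2 + L * ((1 + \<delta>) / 2 * \<bar>x - y\<bar>) / 2"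
      by (intro add_mono divide_right_mono b) auto
    also have "\<dots> = L * ((1 + \<delta>) / 2 * \<bar>x - y\<bar>)" by simp
    finally show ?thesis by (simp add: mult.assoc)
  qed
  have "integral {0..1} (\<lambda>x. q (\<psi> x)) = integral {0..1} (\<lambda>x. Q (\<psi> x))"
    using integral_transfer[OF Suc.prems(1)] by (simp add: Q_def)
  also have "\<dots> \<le> exp (\<delta> / 2) ^ m * integral {0..1} Q + ((1 + \<delta>) / 2) ^ m * (L * ((1 + \<delta>) / 2))"
    by (rule Suc.IH[OF Qc Q0 QL]) (use Suc.prems(4) \<delta>_pos in auto)
  also have "\<dots> \<le> exp (\<delta> / 2) ^ m * (exp (\<delta> / 2) * integral {0..1} q) + ((1 + \<delta>) / 2) ^ m * (L * ((1 + \<delta>) / 2))"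
    unfolding Q_def by (intro add_right_mono mult_left_mono integral_branch_le Suc.prems) auto
  finally show ?case by (simp add: mult_ac)
qed

text \<open>Two parameters remain free: \<open>k\<close> sets the word length and with it the
  energy, while \<open>m\<close> counts the further averagings that wear down the Lipschitz constant
  \<open>2 * |\<xi>|\<close> of the squared wave.\<close>

lemma fourier_norm_sq:
  assumes "2097152 ^ k \<le> \<bar>\<xi>\<bar> * \<delta>\<^sup>2"
  shows "(cmod (integral {0..1} (\<lambda>x. cis (\<xi> * \<psi> x))))\<^sup>2
     \<le> exp (\<delta> / 2) ^ m * (2593 / 2 ^ k) + ((1 + \<delta>) / 2) ^ m * (2 * \<bar>\<xi>\<bar>)"
proof -
  let ?h = "wave (2 * k) \<xi>"
  have c: "continuous_on {0..1} (\<lambda>x. ?h (\<psi> x))"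
    by (rule continuous_on_compose2[OF wave_continuous cont]) (use range in blast)
  have "cmod (integral {0..1} (\<lambda>x. cis (\<xi> * \<psi> x))) = norm (integral {0..1} (\<lambda>x. ?h (\<psi> x)))"
    by (simp add: integral_wave)
  also have "\<dots> \<le> integral {0..1} (\<lambda>x. cmod (?h (\<psi> x)))"
    by (rule integral_norm_bound_integral) (auto intro!: integrable_continuous_real continuous_intros c)
  finally have "(cmod (integral {0..1} (\<lambda>x. cis (\<xi> * \<psi> x))))\<^sup>2 \<le> (integral {0..1} (\<lambda>x. cmod (?h (\<psi> x))))\<^sup>2"
    by (intro power_mono) auto
  also have "\<dots> \<le> integral {0..1} (\<lambda>x. (cmod (?h (\<psi> x)))\<^sup>2)"
    by (intro integral_power2_le continuous_intros c)
  also have "\<dots> \<le> exp (\<delta> / 2) ^ m * integral {0..1} (\<lambda>x. (cmod (?h x))\<^sup>2) + ((1 + \<delta>) / 2) ^ m * (2 * \<bar>\<xi>\<bar>)"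
    by (rule integral_le_lipschitz) (auto intro!: continuous_intros wave_continuous wave_sq_lipschitz)
  also have "\<dots> \<le> exp (\<delta> / 2) ^ m * (2593 / 2 ^ k) + ((1 + \<delta>) / 2) ^ m * (2 * \<bar>\<xi>\<bar>)"
    by (intro add_right_mono mult_left_mono wave_energy assms) auto
  finally show ?thesis .
qed

lemma fourier_norm_le_1: "cmod (integral {0..1} (\<lambda>x. cis (\<xi> * \<psi> x))) \<le> 1"
proof -
  have "continuous_on {0..1} (\<lambda>x. cis (\<xi> * \<psi> x))"
    unfolding cis_conv_exp by (intro continuous_intros cont)
  from integral_bound[OF _ this, of 1] show ?thesis by simp
qed

text \<open>The choice is \<open>2 ^ k\<close> near \<open>(|\<xi>| * \<delta>^2)^(1/21)\<close> and
  \<open>m\<close> near \<open>4 * ln |\<xi>|\<close>. In the square, the gain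
  \<open>|\<xi>|^(-1/21)\<close> outweighs the loss \<open>|\<xi>|^(1/42)\<close>, and the powers of
  \<delta> are rounded up to \<open>\<delta>^-2\<close>; the square root then yields the
  statement.\<close>

lemma fourier_decay:
  assumes \<xi>: "1 \<le> \<bar>\<xi>\<bar>"
  shows "cmod (integral {0..1} (\<lambda>x. cis (\<xi> * \<psi> x))) \<le> 102 * inverse \<delta> * \<bar>\<xi>\<bar> powr (- (1/84))"
proof -
  define X where "X = \<bar>\<xi>\<bar>"
  have X: "1 \<le> X" using assms by (simp add: X_def)
  have \<delta>1: "\<delta> \<le> 1" using \<delta>_le by simp
  let ?I = "cmod (integral {0..1} (\<lambda>x. cis (\<xi> * \<psi> x)))"
  have "?I\<^sup>2 \<le> (102 * inverse \<delta> * X powr (- (1/84)))\<^sup>2"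
  proof (cases "X * \<delta>\<^sup>2 < 1")
    \<comment> \<open>Here \<open>X\<close> is below \<open>\<delta>^-2\<close>, and the trivial
      bound 1 is good enough.\<close>
    case True
    have "?I\<^sup>2 \<le> 1" using fourier_norm_le_1 by (simp add: power_le_one)
    also have "1 \<le> (inverse \<delta> * X powr (- (1/84)))\<^sup>2"
    proof -
      have "1 = X * X powr (- 1)" using X by (simp add: powr_minus)
      also have "\<dots> \<le> (inverse \<delta>)\<^sup>2 * X powr (- (1/42))"
        using True X \<delta>_pos by (intro mult_mono powr_mono) (auto simp: field_simps)
      also have "\<dots> = (inverse \<delta> * X powr (- (1/84)))\<^sup>2"
        using powr_power[of X "- (1/84)" 2] X by (simp add: power_mult_distrib)
      finally show ?thesis .
    qed
    also have "\<dots> \<le> (102 * inverse \<delta> * X powr (- (1/84)))\<^sup>2"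
      using \<delta>_pos by (intro power_mono mult_right_mono) auto
    finally show ?thesis .
  next
    case False
    define Y where "Y = X * \<delta>\<^sup>2"
    have Y: "1 \<le> Y" using False by (simp add: Y_def)
    \<comment> \<open>\<open>2097152 = 2^21\<close>\<close>
    define k where "k = nat \<lfloor>log 2097152 Y\<rfloor>"
    have "0 \<le> log 2097152 Y" using Y by (simp add: zero_le_log_cancel_iff)
    then have k: "real k \<le> log 2097152 Y" "log 2097152 Y < real k + 1" unfolding k_def by linarith+
    have k1: "2097152 ^ k \<le> Y"
      using k(1) Y by (simp add: le_log_iff powr_realpow)
    have k2: "1 / 2 ^ k \<le> 2 * Y powr (- (1/21))"
    proof -
      have "Y < 2097152 powr (real k + 1)" using k(2) Y by (simp add: log_less_iff)
      then have "Y powr (1/21) \<le> (2097152 powr (real k + 1)) powr (1/21)"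
        using Y by (intro powr_mono2) auto
      also have "\<dots> = (2 powr 21) powr ((real k + 1) * (1/21))" by (simp add: powr_powr)
      also have "\<dots> = 2 powr (21 * ((real k + 1) * (1/21)))" by (rule powr_powr)
      also have "21 * ((real k + 1) * (1/21)) = real k + 1" by simp
      also have "2 powr (real k + 1) = 2 * 2 ^ k" by (simp add: powr_add powr_realpow)
      finally show ?thesis using Y by (simp add: powr_minus field_simps)
    qed
    \<comment> \<open>Every averaging shrinks the Lipschitz constant at least by
      \<open>exp (- 1/2)\<close>, so \<open>4 * ln X\<close> of them yield \<open>X^-2\<close>
      against the constant \<open>2 * X\<close>.\<close>
    define m where "m = nat \<lceil>4 * ln X\<rceil>"
    have "0 \<le> ln X" using X by simp
    then have m: "4 * ln X \<le> real m" "real m \<le> 4 * ln X + 1" unfolding m_def by linarith+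
    have m1: "exp (\<delta> / 2) ^ m \<le> 2 * X powr (1/42)"
    proof -
      have le: "real m * (\<delta> / 2) \<le> (4 * ln X + 1) * (1 / 168)"
        using m \<delta>_pos \<delta>_le \<open>0 \<le> ln X\<close> by (intro mult_mono) auto
      have e: "exp (1/168 :: real) \<le> 2"
        using exp_bound[of "1/168"] by (simp add: power2_eq_square)
      have "exp (\<delta> / 2) ^ m = exp (real m * (\<delta> / 2))" by (rule exp_of_nat_mult[symmetric])
      also have "\<dots> \<le> exp ((4 * ln X + 1) * (1 / 168))" using le by simp
      also have "(4 * ln X + 1) * (1 / 168) = 1/168 + 1/42 * ln X" by simp
      also have "exp (1/168 + 1/42 * ln X) = exp (1/168) * X powr (1/42)"
        using X by (simp add: exp_add powr_def)
      also have "\<dots> \<le> 2 * X powr (1/42)" using e by (intro mult_right_mono) auto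
      finally show ?thesis .
    qed
    have m2: "((1 + \<delta>) / 2) ^ m \<le> X powr (- 2)"
    proof -
      have "exp (1/2 :: real) \<le> 7/4" using exp_bound[of "1/2"] by (simp add: power2_eq_square)
      then have "inverse (7/4) \<le> inverse (exp (1/2 :: real))" by (intro le_imp_inverse_le) auto
      then have "(1 + \<delta>) / 2 \<le> exp (- (1/2))" using \<delta>_le by (simp add: exp_minus)
      then have "((1 + \<delta>) / 2) ^ m \<le> exp (- (1/2)) ^ m" using \<delta>_pos by (intro power_mono) auto
      also have "\<dots> = exp (real m * (- (1/2)))" by (rule exp_of_nat_mult[symmetric])
      also have "\<dots> \<le> exp (- 2 * ln X)" using m by simp
      also have "\<dots> = X powr (- 2)" using X by (simp add: powr_def)
      finally show ?thesis .
    qed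
    have XY: "X powr (1/42) * Y powr (- (1/21)) \<le> (inverse \<delta>)\<^sup>2 * X powr (- (1/42))"
    proof -
      have 1: "Y powr (- (1/21)) = X powr (- (1/21)) * (\<delta>\<^sup>2) powr (- (1/21))"
        using X unfolding Y_def by (simp add: powr_mult)
      have "(\<delta>\<^sup>2) powr (- (1/21)) \<le> (\<delta>\<^sup>2) powr (- 1)"
        using \<delta>_pos \<delta>1 by (intro powr_mono') (auto simp: power_le_one)
      also have "(\<delta>\<^sup>2) powr (- 1) = (inverse \<delta>)\<^sup>2"
        using \<delta>_pos by (simp add: powr_minus power_inverse)
      finally have 2: "(\<delta>\<^sup>2) powr (- (1/21)) \<le> (inverse \<delta>)\<^sup>2" .
      have "X powr (1/42) * Y powr (- (1/21)) = (\<delta>\<^sup>2) powr (- (1/21)) * (X powr (1/42) * X powr (- (1/21)))"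
        unfolding 1 by (simp only: mult_ac)
      also have "X powr (1/42) * X powr (- (1/21)) = X powr (- (1/42))"
        by (simp flip: powr_add)
      also have "(\<delta>\<^sup>2) powr (- (1/21)) * X powr (- (1/42)) \<le> (inverse \<delta>)\<^sup>2 * X powr (- (1/42))"
        by (intro mult_right_mono 2) simp
      finally show ?thesis .
    qed
    have "?I\<^sup>2 \<le> exp (\<delta> / 2) ^ m * (2593 * (1 / 2 ^ k)) + ((1 + \<delta>) / 2) ^ m * (2 * X)"
      using fourier_norm_sq[of k \<xi> m] k1 by (simp add: Y_def X_def)
    also have "\<dots> \<le> (2 * X powr (1/42)) * (2593 * (2 * Y powr (- (1/21)))) + X powr (- 2) * (2 * X)"
      using m1 m2 k2 X by (intro add_mono mult_mono) auto
    also have "X powr (- 2) * (2 * X) = 2 * X powr (- 1)"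
      using X powr_add[of X "- 2" 1] by simp
    finally have I: "?I\<^sup>2 \<le> 10372 * (X powr (1/42) * Y powr (- (1/21))) + 2 * X powr (- 1)"
      by (simp only: mult_ac)
    have "X powr (- 1) \<le> X powr (- (1/42))" by (rule powr_mono) (use X in auto)
    also have "\<dots> = 1 * X powr (- (1/42))" by simp
    also have "\<dots> \<le> (inverse \<delta>)\<^sup>2 * X powr (- (1/42))"
      using \<delta>_pos \<delta>1 by (intro mult_right_mono) (auto simp: one_le_power one_le_inverse_iff)
    finally have X1: "X powr (- 1) \<le> (inverse \<delta>)\<^sup>2 * X powr (- (1/42))" .
    have "?I\<^sup>2 \<le> 10372 * ((inverse \<delta>)\<^sup>2 * X powr (- (1/42))) + 2 * ((inverse \<delta>)\<^sup>2 * X powr (- (1/42)))"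
      by (rule order_trans[OF I]) (intro add_mono mult_left_mono XY X1; simp)
    also have "\<dots> = 10374 * ((inverse \<delta>)\<^sup>2 * X powr (- (1/42)))" by simp
    \<comment> \<open>Rounding \<open>10374 = 4 * 2593 + 2\<close> up to the square of 102.\<close>
    also have "\<dots> \<le> 10404 * ((inverse \<delta>)\<^sup>2 * X powr (- (1/42)))" by (intro mult_right_mono) auto
    also have "\<dots> = (102 * inverse \<delta> * X powr (- (1/84)))\<^sup>2"
      using powr_power[of X "- (1/84)" 2] X by (simp add: power_mult_distrib)
    finally show ?thesis .
  qed
  then show ?thesis
    unfolding X_def by (rule power2_le_imp_le) (use \<delta>_pos in simp)
qed

end

section \<open>From the conjugacy on the circle to functional equations on the line\<close>

context small_delta
begin

text \<open>By the equation on the circle, \<open>f (\<psi> (x / 2)) - \<psi> x\<close> is an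
  integer; it is continuous, hence constant, and vanishes at \<open>x = 0\<close>. The expression
  for the other half is evaluated at \<open>x = 1\<close>, where it equals 1. Injectivity of
  \<open>f\<close> then identifies the branch.\<close>

lemma conjugated_of_conjugacy:
  assumes "conjugacy \<delta> \<psi>"
  shows "conjugated \<delta> \<psi>"
proof -
  obtain \<phi> \<Psi> where mono: "strict_mono_on {0..1} \<psi>" and hom: "homeomorphism {0..1} {0..1} \<psi> \<phi>"
    and circ: "circle_conjugacy \<delta> \<Psi>" and lift: "\<And>x. x \<in> {0..1} \<Longrightarrow> \<Psi> (circ x) = circ (\<psi> x)"
    using assms unfolding conjugacy_def by blast
  have cont: "continuous_on {0..1} \<psi>" and img: "\<psi> ` {0..1} = {0..1}"
    using hom by (auto simp: homeomorphism_def)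
  have range: "\<psi> x \<in> {0..1}" if "x \<in> {0..1}" for x using img that by blast
  have psi0: "\<psi> 0 = 0"
  proof -
    have "0 \<in> \<psi> ` {0..1}" unfolding img by simp
    then obtain t where t: "t \<in> {0..1}" "\<psi> t = 0" by force
    then show ?thesis using strict_mono_onD[OF mono, of 0 t] range[of 0] by (cases "t = 0") auto
  qed
  have psi1: "\<psi> 1 = 1"
  proof -
    have "1 \<in> \<psi> ` {0..1}" unfolding img by simp
    then obtain t where t: "t \<in> {0..1}" "\<psi> t = 1" by force
    then show ?thesis using strict_mono_onD[OF mono, of t 1] range[of 1] by (cases "t = 1") auto
  qed
  have eqv: "circ (f (\<psi> y)) = circ (\<psi> x)" if "x \<in> {0..1}" "y \<in> {0..1}" "circ x = circ (2 * y)" for x y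
  proof -
    have "\<Psi> (circle_map (f_delta 0) (circ y)) = circle_map f (\<Psi> (circ y))"
      using circ circ_in_sphere[of y] by (auto simp: circle_conjugacy_def simp del: mem_sphere_0)
    then have "\<Psi> (circ (2 * y)) = circ (f (\<psi> y))"
      by (simp add: circle_map_f_delta f_delta_0 lift[OF that(2)])
    then show ?thesis using lift[OF that(1)] that(3) by simp
  qed
  have f1: "f 1 = 2" using f_delta_add_1[of \<delta> 0] by (simp add: f_delta_at_0)
  have c1: "continuous_on {0..1} (\<lambda>x. f (\<psi> (x / 2)) - \<psi> x)"
    using \<delta>_pos by (intro continuous_intros cont continuous_on_compose2[OF continuous_f_delta[of \<delta> UNIV]]
        continuous_on_compose2[OF cont]) auto
  have c2: "continuous_on {0..1} (\<lambda>x. f (\<psi> ((x + 1) / 2)) - \<psi> x)"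
    using \<delta>_pos by (intro continuous_intros cont continuous_on_compose2[OF continuous_f_delta[of \<delta> UNIV]]
        continuous_on_compose2[OF cont]) auto
  have i1: "f (\<psi> (x / 2)) - \<psi> x \<in> \<int>" if "x \<in> {0..1}" for x
    using eqv[of x "x / 2"] that by (simp add: circ_eq_iff)
  have i2: "f (\<psi> ((x + 1) / 2)) - \<psi> x \<in> \<int>" if "x \<in> {0..1}" for x
    
  proof -
    have "x - 2 * ((x + 1) / 2) = - 1" by (simp add: field_simps)
    then have "circ x = circ (2 * ((x + 1) / 2))" unfolding circ_eq_iff by simp
    from eqv[OF that _ this] that show ?thesis by (simp add: circ_eq_iff)
  qed
  have inj: "f s = f t \<Longrightarrow> s = t" for s t
    using strict_mono_f_delta[of \<delta>] \<delta>_pos by (simp add: strict_mono_eq)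
  show ?thesis
  proof unfold_locales
    show "\<psi> (x / 2) = branch False (\<psi> x)" if x: "x \<in> {0..1}" for x
      by (rule inj)
         (use continuous_Ints_constant[OF c1 i1 x, of 0] f_branch[OF range[OF x], of False] psi0 in
           \<open>simp add: f_delta_at_0\<close>)
    show "\<psi> ((x + 1) / 2) = branch True (\<psi> x)" if x: "x \<in> {0..1}" for x
    proof (rule inj)
      have "f (\<psi> ((x + 1) / 2)) - \<psi> x = f (\<psi> ((1 + 1) / 2)) - \<psi> 1"
        by (rule continuous_Ints_constant[OF c2 i2 x]) auto
      also have "\<dots> = 1" by (simp add: psi1 f1)
      finally have "f (\<psi> ((x + 1) / 2)) = \<psi> x + 1" by (simp only: diff_eq_eq add.commute)
      also have "\<dots> = f (branch True (\<psi> x))" using f_branch[OF range[OF x], of True] by simp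
      finally show "f (\<psi> ((x + 1) / 2)) = f (branch True (\<psi> x))" .
    qed
  qed (use cont range in auto)
qed

end

theorem theorem1p6:
  shows "\<exists>C>0. \<exists>\<rho>>0. \<exists>\<delta>\<^sub>0>0. \<forall>\<delta>::real. 0 < \<delta> \<and> \<delta> < \<delta>\<^sub>0 \<longrightarrow>
    (\<exists>\<psi>. conjugacy \<delta> \<psi>) \<and>
    (\<forall>\<psi>. conjugacy \<delta> \<psi> \<longrightarrow>
      (\<forall>\<xi>::real. \<bar>\<xi>\<bar> \<ge> 1 \<longrightarrow>
        cmod (LBINT x=0..1. exp (\<i> * complex_of_real (\<xi> * \<psi> x)))
          \<le> C * inverse \<delta> * \<bar>\<xi>\<bar> powr (- \<rho>)))"
proof -
  have "(\<exists>\<psi>. conjugacy \<delta> \<psi>) \<and> (\<forall>\<psi>. conjugacy \<delta> \<psi> \<longrightarrow> (\<forall>\<xi>::real. \<bar>\<xi>\<bar> \<ge> 1 \<longrightarrow>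
      cmod (LBINT x=0..1. exp (\<i> * complex_of_real (\<xi> * \<psi> x)))
        \<le> 102 * inverse \<delta> * \<bar>\<xi>\<bar> powr (- (1/84))))"
    if "0 < \<delta>" "\<delta> < 1/100" for \<delta> :: real
  proof (intro conjI allI impI)
    interpret small_delta \<delta> using that by unfold_locales auto
    show "\<exists>\<psi>. conjugacy \<delta> \<psi>" using conjugacy_psi by blast
    fix \<psi> and \<xi> :: real assume \<psi>: "conjugacy \<delta> \<psi>" and \<xi>: "1 \<le> \<bar>\<xi>\<bar>"
    interpret conjugated \<delta> \<psi> by (rule conjugated_of_conjugacy[OF \<psi>])
    have "continuous_on {0..1} (\<lambda>x. exp (\<i> * complex_of_real (\<xi> * \<psi> x)))"
      by (intro continuous_intros cont)
    then have "(LBINT x=0..1. exp (\<i> * complex_of_real (\<xi> * \<psi> x)))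
        = integral {0..1} (\<lambda>x. exp (\<i> * complex_of_real (\<xi> * \<psi> x)))"
      using interval_integral_eq_integral[of 0 1, OF _ borel_integrable_atLeastAtMost']
      by (simp add: zero_ereal_def one_ereal_def)
    then show "cmod (LBINT x=0..1. exp (\<i> * complex_of_real (\<xi> * \<psi> x)))
        \<le> 102 * inverse \<delta> * \<bar>\<xi>\<bar> powr (- (1/84))"
      using fourier_decay[OF \<xi>] by (simp add: cis_conv_exp)
  qed
  then show ?thesis
    by (intro exI[of _ 102] exI[of _ "1/84"] exI[of _ "1/100"] conjI allI impI) auto
qed

end
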